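(* Let $k\ge 1$. Suppose the density of the set of trajectories at time $k-1$ (given measurements up to time $k-1$) is a trajectory MBM with $n_{k-1|k-1}$ tracks, track $i$ having $h^i_{k-1|k-1}$ single trajectory hypotheses with parameters $(w^{i,a^i}_{k-1|k-1}, r^{i,a^i}_{k-1|k-1}, f^{i,a^i}_{k-1|k-1})$ and measurement histories $\mathcal{M}^{k-1}(i,a^i)$. Suppose each trajectory evolves according to the transition model for the set of current trajectories, and new trajectories are born according to an independent trajectory multi-Bernoulli RFS with $n^b_k$ components, component $l$ having existence probability $r^{b,l}_k$ and density $f^{B,l}_k$. Then the predicted density at time $k$ is a trajectory MBM with $n_{k|k-1}=n_{k-1|k-1}+n^b_k$ tracks and the following parameters. For tracks $i\in\{1,\dots,n_{k-1|k-1}\}$: $h^i_{k|k-1}=h^i_{k-1|k-1}$, measurement histories unchanged, and for all $a^i$, $$w^{i,a^i}_{k|k-1}=w^{i,a^i}_{k-1|k-1},\quad r^{i,a^i}_{k|k-1}=r^{i,a^i}_{k-1|k-1}\langle f^{i,a^i}_{k-1|k-1};P^S_{k-1}\rangle,\quad f^{i,a^i}_{k|k-1}(X)=\frac{\int \pi^c(X|X')P^S_{k-1}(X')f^{i,a^i}_{k-1|k-1}(X')dX'}{\langle f^{i,a^i}_{k-1|k-1};P^S_{k-1}\rangle}.$$ For new tracks $i=n_{k-1|k-1}+l$, $l\in\{1,\dots,n^b_k\}$: $h^i_{k|k-1}=1$, $\mathcal{M}^{k-1}(i,1)=\emptyset$, $w^{i,1}_{k|k-1}=1$, $r^{i,1}_{k|k-1}=r^{b,l}_k$,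 $f^{i,1}_{k|k-1}=f^{B,l}_k$. The set of global hypotheses is the set of old global hypotheses each extended by $a^i=1$ for every new track.
   Context: Single target state space $\mathcal{X}=\mathbb{R}^n$. A trajectory is $X=(\beta,\varepsilon,x_{\beta:\varepsilon})$ with integers $0\le\beta\le\varepsilon\le k$ (start and end time) and $x_{\beta:\varepsilon}=(x_\beta,\dots,x_\varepsilon)\in\mathcal{X}^{\varepsilon-\beta+1}$; the trajectory space at time $k$ is $\mathcal{T}_k=\biguplus_{0\le\beta\le\varepsilon\le k}\{\beta\}\times\{\varepsilon\}\times\mathcal{X}^{\varepsilon-\beta+1}$, with $\int p(X)dX=\sum_{(\beta,\varepsilon)}\int p(\beta,\varepsilon,x_{\beta:\varepsilon})dx_{\beta:\varepsilon}$. Set integral: $\int g(\mathbf{X})\delta\mathbf{X}=g(\emptyset)+\sum_{n\ge1}\frac1{n!}\int g(\{X^1,\dots,X^n\})dX^1\cdots dX^n$. Notation $\langle h;g\rangle=\int h(X)g(X)dX$. $\Delta_a(b)$ is the Kronecker delta, $\delta$ the Dirac delta. A Bernoulli density with parameters $(r,f)$ is $1-r$ at $\emptyset$, $rf(X)$ at $\{X\}$, $0$ otherwise. A trajectory MBM with track table $\mathbb{T}=\{1,\dots,n\}$, track $i$ having hypotheses $a^i\in\{1,\dots,h^i\}$ each with weight $w^{i,a^i}$, Bernoulli parameters $(r^{i,a^i},f^{i,a^i})$ and measurement history $\mathcal{M}(i,a^i)$ (a set of pairs $(\tau,j)$, measurement $j$ at time $\tau$, at most one per time), is the density $f(\mathbf{X})=\sum_{a\in\mathcal{A}}w^a\sum_{\uplus_{i\in\mathbb{T}}\mathbf{X}^i=\mathbf{X}}\prod_{i\in\mathbb{T}}f^{i,a^i}(\mathbf{X}^i)$,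 where $f^{i,a^i}(\cdot)$ is the Bernoulli density with parameters $(r^{i,a^i},f^{i,a^i})$, $\mathcal{A}$ is the set of global hypotheses $a=(a^1,\dots,a^n)$ whose histories $\mathcal{M}(i,a^i)$ are pairwise disjoint subsets of the set of all measurement indices received so far, and $w^a\propto\prod_i w^{i,a^i}$ normalized over $\mathcal{A}$. Transition model for the set of current trajectories: a single trajectory $X'$ at time $k-1$ survives with probability $P^S_{k-1}(X')=P^S(x'_{\varepsilon'})\Delta_{k-1}(\varepsilon')$ (otherwise it disappears from the set) and, if it survives, becomes $X$ with density $\pi^c(X|X')=\pi^x(x_\varepsilon|x'_{\varepsilon'})\delta_{x'_{\beta':\varepsilon'}}(x_{\beta:\varepsilon-1})\Delta_{\varepsilon'+1}(\varepsilon)\Delta_{\beta'}(\beta)$, where $\pi^x$ is the single-target Markov transition density; trajectories evolve independently. Birth component densities: $f^{B,l}_k(X)=f^{b,l}_k(x_k)\Delta_k(\beta)\Delta_k(\varepsilon)$ with $f^{b,l}_k$ a density on $\mathcal{X}$. *)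

theory Defs
  imports "HOL-Probability.Probability"
begin

text \<open>A trajectory (beta, eps, x) where x is an extensional function on {beta..eps}
  (the tuple x_{beta:eps}).  The state space is an arbitrary Euclidean space 'a
  (playing the role of R^n) with Lebesgue measure.\<close>

type_synonym 'a traj = "nat \<times> nat \<times> (nat \<Rightarrow> 'a)"

definition trajM :: "nat \<Rightarrow> nat \<Rightarrow> (nat \<Rightarrow> 'a::euclidean_space) measure" where
  "trajM b e = PiM {b..e} (\<lambda>_. lborel)"

definition BE :: "nat \<Rightarrow> (nat \<times> nat) set" where
  "BE k = {(b, e). b \<le> e \<and> e \<le> k}"

definition tint :: "nat \<Rightarrow> ('a::euclidean_space traj \<Rightarrow> ennreal) \<Rightarrow> ennreal" where
  "tint k g = (\<Sum>be\<in>BE k. \<integral>\<^sup>+ x. g (fst be, snd be, x) \<partial>trajM (fst be) (snd be))"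

fun mint :: "nat \<Rightarrow> nat \<Rightarrow> ('a::euclidean_space traj list \<Rightarrow> ennreal) \<Rightarrow> ennreal" where
  "mint k 0 G = G []"
| "mint k (Suc n) G = tint k (\<lambda>X. mint k n (\<lambda>xs. G (X # xs)))"

definition setintL :: "nat \<Rightarrow> ('a::euclidean_space traj list \<Rightarrow> ennreal) \<Rightarrow> ennreal" where
  "setintL k G = (\<Sum>n. mint k n G / of_nat (fact n))"

definition setint :: "nat \<Rightarrow> ('a::euclidean_space traj set \<Rightarrow> ennreal) \<Rightarrow> ennreal" where
  "setint k g = setintL k (\<lambda>xs. g (set xs))"

definition set_fun_measurable :: "nat \<Rightarrow> ('a::euclidean_space traj set \<Rightarrow> ennreal) \<Rightarrow> bool" where
  "set_fun_measurable k \<phi> \<longleftrightarrow>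
     (\<forall>bes. set bes \<subseteq> BE k \<longrightarrow>
        (\<lambda>y. \<phi> (set (map (\<lambda>i. (fst (bes!i), snd (bes!i), y i)) [0..<length bes])))
          \<in> borel_measurable (PiM {..<length bes} (\<lambda>i. trajM (fst (bes!i)) (snd (bes!i)))))"

definition traj_density :: "nat \<Rightarrow> ('a::euclidean_space traj \<Rightarrow> real) \<Rightarrow> bool" where
  "traj_density k f \<longleftrightarrow> (\<forall>X. 0 \<le> f X)
     \<and> (\<forall>be\<in>BE k. (\<lambda>x. f (fst be, snd be, x)) \<in> borel_measurable (trajM (fst be) (snd be)))
     \<and> tint k (\<lambda>X. ennreal (f X)) = 1"

definition bern :: "real \<Rightarrow> ('a traj \<Rightarrow> real) \<Rightarrow> 'a traj set \<Rightarrow> real" where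
  "bern r f S = (if S = {} then 1 - r else if (\<exists>X. S = {X}) then r * f (the_elem S) else 0)"

text \<open>Global hypotheses: a = (a^1..a^n), a^i \<in> {1..h^i}, histories pairwise disjoint
  subsets of the set meas of all measurement indices received so far.\<close>
definition glob_hyps :: "nat \<Rightarrow> (nat \<Rightarrow> nat) \<Rightarrow> (nat \<Rightarrow> nat \<Rightarrow> (nat \<times> nat) set)
    \<Rightarrow> (nat \<times> nat) set \<Rightarrow> (nat \<Rightarrow> nat) set" where
  "glob_hyps n h hist meas = {a \<in> PiE {1..n} (\<lambda>i. {1..h i}).
      (\<forall>i\<in>{1..n}. hist i (a i) \<subseteq> meas)
    \<and> (\<forall>i\<in>{1..n}. \<forall>j\<in>{1..n}. i \<noteq> j \<longrightarrow> hist i (a i) \<inter> hist j (a j) = {})}"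

definition decomps :: "nat \<Rightarrow> 'b set \<Rightarrow> (nat \<Rightarrow> 'b set) set" where
  "decomps n X = {Xs \<in> PiE {1..n} (\<lambda>_. Pow X). (\<Union>i\<in>{1..n}. Xs i) = X
      \<and> (\<forall>i\<in>{1..n}. \<forall>j\<in>{1..n}. i \<noteq> j \<longrightarrow> Xs i \<inter> Xs j = {})}"

definition mbm :: "nat \<Rightarrow> (nat \<Rightarrow> nat) \<Rightarrow> (nat \<Rightarrow> nat \<Rightarrow> real) \<Rightarrow> (nat \<Rightarrow> nat \<Rightarrow> real)
    \<Rightarrow> (nat \<Rightarrow> nat \<Rightarrow> 'a traj \<Rightarrow> real) \<Rightarrow> (nat \<Rightarrow> nat \<Rightarrow> (nat \<times> nat) set)
    \<Rightarrow> (nat \<times> nat) set \<Rightarrow> 'a traj set \<Rightarrow> real" where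
  "mbm n h w r f hist meas X =
     (let A = glob_hyps n h hist meas;
          W = (\<lambda>a. \<Prod>i\<in>{1..n}. w i (a i))
      in \<Sum>a\<in>A. (W a / (\<Sum>b\<in>A. W b)) *
           (\<Sum>Xs\<in>decomps n X. \<Prod>i\<in>{1..n}. bern (r i (a i)) (f i (a i)) (Xs i)))"

definition PSk :: "nat \<Rightarrow> ('a \<Rightarrow> real) \<Rightarrow> 'a traj \<Rightarrow> real" where
  "PSk k PS X = (case X of (b, e, x) \<Rightarrow> if e = k - 1 then PS (x e) else 0)"

text \<open>Extension of a trajectory by a new final state (the support of \<pi>^c(.|X')).\<close>
definition ext_traj :: "'a traj \<Rightarrow> 'a \<Rightarrow> 'a traj" where
  "ext_traj X y = (case X of (b, e, x) \<Rightarrow> (b, Suc e, x(Suc e := y)))"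

text \<open>Expectation of a test function \<phi> of the set at time k given the list of
  trajectories at time k-1: each trajectory independently disappears with probability
  1 - P^S_{k-1}, or survives and moves according to \<pi>^c (integration against \<pi>^c
  with its Dirac delta carried out: the new final state y has density pix (x'_{eps'}) y);
  B gives the expectation over the independent birth set.\<close>
primrec survE :: "nat \<Rightarrow> ('a::euclidean_space \<Rightarrow> real) \<Rightarrow> ('a \<Rightarrow> 'a \<Rightarrow> real)
    \<Rightarrow> (('a traj set \<Rightarrow> ennreal) \<Rightarrow> ennreal) \<Rightarrow> ('a traj set \<Rightarrow> ennreal) \<Rightarrow> 'a traj list \<Rightarrow> ennreal" where
  "survE k PS pix B \<phi> [] = B \<phi>"
| "survE k PS pix B \<phi> (X # xs) =
     ennreal (1 - PSk k PS X) * survE k PS pix B \<phi> xs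
   + ennreal (PSk k PS X) *
       (\<integral>\<^sup>+ y. ennreal (pix (snd (snd X) (fst (snd X))) y) *
                 survE k PS pix B (\<lambda>S. \<phi> (insert (ext_traj X y) S)) xs \<partial>lborel)"

text \<open>Expectation over an independent trajectory multi-Bernoulli birth set at time k,
  components listed in ls, with existence probabilities rb and densities fB.\<close>
primrec birthE :: "nat \<Rightarrow> (nat \<Rightarrow> real) \<Rightarrow> (nat \<Rightarrow> 'a::euclidean_space traj \<Rightarrow> real) \<Rightarrow> nat list
    \<Rightarrow> ('a traj set \<Rightarrow> ennreal) \<Rightarrow> ennreal" where
  "birthE k rb fB [] \<phi> = \<phi> {}"
| "birthE k rb fB (l # ls) \<phi> =
     ennreal (1 - rb l) * birthE k rb fB ls \<phi>
   + ennreal (rb l) * tint k (\<lambda>X. ennreal (fB l X) * birthE k rb fB ls (\<lambda>S. \<phi> (insert X S)))"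

definition birth_traj_density :: "nat \<Rightarrow> ('a \<Rightarrow> real) \<Rightarrow> 'a traj \<Rightarrow> real" where
  "birth_traj_density k fb X = (case X of (b, e, x) \<Rightarrow> if b = k \<and> e = k then fb (x k) else 0)"

definition inner_PS :: "nat \<Rightarrow> ('a::euclidean_space \<Rightarrow> real) \<Rightarrow> ('a traj \<Rightarrow> real) \<Rightarrow> real" where
  "inner_PS k PS f = enn2real (tint (k - 1) (\<lambda>X. ennreal (f X * PSk k PS X)))"

text \<open>\<integral> \<pi>^c(X|X') P^S_{k-1}(X') f(X') dX' with the Kronecker and Dirac deltas
  evaluated: nonzero only if eps = k and beta \<le> k-1, where X' = (beta, k-1, x_{beta:k-1}).\<close>
definition pred_num :: "nat \<Rightarrow> ('a \<Rightarrow> real) \<Rightarrow> ('a \<Rightarrow> 'a \<Rightarrow> real) \<Rightarrow> ('a traj \<Rightarrow> real) \<Rightarrow> 'a traj \<Rightarrow> real" where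
  "pred_num k PS pix f X = (case X of (b, e, x) \<Rightarrow>
     if e = k \<and> b \<le> k - 1
     then pix (x (k - 1)) (x k) * PSk k PS (b, k - 1, restrict x {b..k - 1}) * f (b, k - 1, restrict x {b..k - 1})
     else 0)"

definition pred_density :: "nat \<Rightarrow> ('a::euclidean_space \<Rightarrow> real) \<Rightarrow> ('a \<Rightarrow> 'a \<Rightarrow> real) \<Rightarrow> ('a traj \<Rightarrow> real) \<Rightarrow> 'a traj \<Rightarrow> real" where
  "pred_density k PS pix f X = pred_num k PS pix f X / inner_PS k PS f"

end

theory Submission
  imports Defs
begin

text \<open>
  A multi-Bernoulli density with \<open>n\<close> components satisfies a recursion in \<open>n\<close>: the last component
  either is empty or picks one element of the set. In the set integral of a symmetric function \<open>G\<close>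
  the factor \<open>1 / n!\<close> absorbs the choice of the picked element, so one component can be traded for
  the operator \<open>T G zs = (1 - r) * G zs + r * \<integral> f X * G (X # zs) dX\<close>. Iterating, the set integral
  equals \<open>(T\<^sub>1 \<circ> \<dots> \<circ> T\<^sub>n) G []\<close>. Birth and the survival of a single trajectory are operators of the
  same shape, any two of which commute on symmetric functions by Fubini. Applying the prior
  operator \<open>T\<close> and then survival amounts to applying the predicted operator: the mass
  \<open>r * \<langle>f; 1 - P\<^sup>S\<rangle>\<close> of disappearing trajectories joins \<open>1 - r\<close>, and the surviving part is
  rewritten by a change of variables. So prior components can be replaced by predicted ones one at
  a time, and the mixture follows by linearity over the global hypotheses.
\<close>

section \<open>The measure space of trajectories\<close>

text \<open>The set integral evaluates a function of a set on lists, so at a list with a repeated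
  entry the density is that of a smaller set, and the recursion over components breaks. Such lists
  are discarded as a null set: every trajectory has at least one state (\<open>b \<le> e\<close>),
  and Lebesgue measure has no atoms. Survival has no density with respect to the measure on
  trajectories: given the prior trajectory, all states but the new last one are fixed. It therefore
  enters only through test functions, and each operator carries its own integration space. A further
  obstacle is that \<open>mint\<close> is an iterated integral, whose order can be changed only
  under joint measurability. Hence trajectories and lists of trajectories become sigma-finite
  measure spaces, and the survival recursion is viewed as a function of two lists: the prior
  trajectories still to be processed and the trajectories already inserted. Prior components act on
  the first list, predicted ones on the second, and the final identity is read off with both lists
  empty.\<close>

lemma finite_BE [simp]: "finite (BE k)"
proof -
  have "BE k \<subseteq> {..k} \<times> {..k}" by (auto simp: BE_def)
  then show ?thesis by (rule finite_subset) auto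
qed

definition traj_slice :: "nat \<times> nat \<Rightarrow> 'a::euclidean_space traj set \<Rightarrow> (nat \<Rightarrow> 'a) set" where
  "traj_slice be A = {x \<in> space (trajM (fst be) (snd be)). (fst be, snd be, x) \<in> A}"

definition traj_space :: "nat \<Rightarrow> 'a::euclidean_space traj set" where
  "traj_space k = {(b, e, x). (b, e) \<in> BE k \<and> x \<in> space (trajM b e)}"

text \<open>The final sigma-algebra of the injections of the components
  \<open>{b} \<times> {e} \<times> space (trajM b e)\<close>. This choice makes measurability out of
  the sum a condition on each component, which is the form in which the hypotheses on densities are
  given.\<close>

definition traj_sets :: "nat \<Rightarrow> 'a::euclidean_space traj set set" where
  "traj_sets k = {A. A \<subseteq> traj_space k \<and>
     (\<forall>be\<in>BE k. traj_slice be A \<in> sets (trajM (fst be) (snd be)))}"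

text \<open>The direct sum of the measures \<open>trajM b e\<close>; it represents \<open>tint k\<close> on measurable functions.\<close>
definition trajS :: "nat \<Rightarrow> 'a::euclidean_space traj measure" where
  "trajS k = measure_of (traj_space k) (traj_sets k)
     (\<lambda>A. \<Sum>be\<in>BE k. emeasure (trajM (fst be) (snd be)) (traj_slice be A))"

lemma sigma_algebra_traj_sets: "sigma_algebra (traj_space k) (traj_sets k)"
  unfolding sigma_algebra_iff2
proof (intro conjI ballI allI impI)
  show "traj_sets k \<subseteq> Pow (traj_space k)" by (auto simp: traj_sets_def)
  show "{} \<in> traj_sets k" by (auto simp: traj_sets_def traj_slice_def)
next
  fix A :: "'a traj set" assume A: "A \<in> traj_sets k"
  have "traj_slice be (traj_space k - A) = space (trajM (fst be) (snd be)) - traj_slice be A"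
    if "be \<in> BE k" for be
    using that by (auto simp: traj_slice_def traj_space_def)
  with A show "traj_space k - A \<in> traj_sets k" by (auto simp: traj_sets_def)
next
  fix A :: "nat \<Rightarrow> 'a traj set" assume A: "range A \<subseteq> traj_sets k"
  have "traj_slice be (\<Union>i. A i) = (\<Union>i. traj_slice be (A i))" for be
    by (auto simp: traj_slice_def)
  with A show "(\<Union>i. A i) \<in> traj_sets k" by (auto simp: traj_sets_def)
qed

lemma space_trajS: "space (trajS k) = traj_space k"
  unfolding trajS_def by (rule space_measure_of) (auto simp: traj_sets_def)

lemma sets_trajS: "sets (trajS k) = traj_sets k"
  unfolding trajS_def using sigma_algebra_traj_sets sigma_algebra.sets_measure_of_eq by blast

lemma emeasure_trajS:
  fixes A :: "'a::euclidean_space traj set"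
  assumes "A \<in> sets (trajS k)"
  shows "emeasure (trajS k) A = (\<Sum>be\<in>BE k. emeasure (trajM (fst be) (snd be)) (traj_slice be A))"
  unfolding trajS_def
proof (rule emeasure_measure_of_sigma)
  show "sigma_algebra (traj_space k) (traj_sets k)" by (rule sigma_algebra_traj_sets)
  let ?\<mu> = "\<lambda>A :: 'a traj set. \<Sum>be\<in>BE k. emeasure (trajM (fst be) (snd be)) (traj_slice be A)"
  show "positive (traj_sets k) ?\<mu>"
    by (auto simp: positive_def traj_slice_def)
  show "countably_additive (traj_sets k) ?\<mu>"
  proof (rule countably_additiveI)
    fix A :: "nat \<Rightarrow> 'a traj set"
    assume A: "range A \<subseteq> traj_sets k" "disjoint_family A"
    have U: "traj_slice be (\<Union>i. A i) = (\<Union>i. traj_slice be (A i))" for be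
      by (auto simp: traj_slice_def)
    have "(\<Sum>i. ?\<mu> (A i))
        = (\<Sum>be\<in>BE k. \<Sum>i. emeasure (trajM (fst be) (snd be)) (traj_slice be (A i)))"
      by (rule suminf_sum) (auto intro: summableI)
    also have "\<dots> = ?\<mu> (\<Union>i. A i)"
    proof (rule sum.cong[OF refl])
      fix be assume be: "be \<in> BE k"
      have "range (\<lambda>i. traj_slice be (A i)) \<subseteq> sets (trajM (fst be) (snd be))"
        using A(1) be by (auto simp: traj_sets_def)
      moreover have "disjoint_family (\<lambda>i. traj_slice be (A i))"
        using A(2) by (auto simp: disjoint_family_on_def traj_slice_def)
      ultimately show "(\<Sum>i. emeasure (trajM (fst be) (snd be)) (traj_slice be (A i)))
          = emeasure (trajM (fst be) (snd be)) (traj_slice be (\<Union>i. A i))"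
        unfolding U by (rule suminf_emeasure)
    qed
    finally show "(\<Sum>i. ?\<mu> (A i)) = ?\<mu> (\<Union>i. A i)" .
  qed
qed (use assms in \<open>simp add: sets_trajS\<close>)

lemma measurable_trajS_iff:
  "g \<in> measurable (trajS k) N \<longleftrightarrow>
    (\<forall>be\<in>BE k. (\<lambda>x. g (fst be, snd be, x)) \<in> measurable (trajM (fst be) (snd be)) N)"
proof
  assume g: "g \<in> measurable (trajS k) N"
  have inj: "(\<lambda>x::nat \<Rightarrow> 'a. (fst be, snd be, x)) \<in> measurable (trajM (fst be) (snd be)) (trajS k)"
    if be: "be \<in> BE k" for be
  proof (rule measurableI)
    fix A :: "'a traj set" assume "A \<in> sets (trajS k)"
    moreover have "(\<lambda>x. (fst be, snd be, x)) -` A \<inter> space (trajM (fst be) (snd be)) = traj_slice be A"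
      by (auto simp: traj_slice_def)
    ultimately show "(\<lambda>x. (fst be, snd be, x)) -` A \<inter> space (trajM (fst be) (snd be))
        \<in> sets (trajM (fst be) (snd be))"
      using be by (simp add: sets_trajS traj_sets_def)
  qed (use be in \<open>auto simp: space_trajS traj_space_def\<close>)
  show "\<forall>be\<in>BE k. (\<lambda>x. g (fst be, snd be, x)) \<in> measurable (trajM (fst be) (snd be)) N"
    using measurable_compose[OF inj g] by blast
next
  assume g: "\<forall>be\<in>BE k. (\<lambda>x. g (fst be, snd be, x)) \<in> measurable (trajM (fst be) (snd be)) N"
  show "g \<in> measurable (trajS k) N"
  proof (rule measurableI)
    fix X :: "'a traj" assume X: "X \<in> space (trajS k)"
    then obtain b e x where "X = (b, e, x)" "(b, e) \<in> BE k" "x \<in> space (trajM b e)"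
      by (auto simp: space_trajS traj_space_def)
    with bspec[OF g, of "(b, e)"] show "g X \<in> space N" by (auto dest: measurable_space)
  next
    fix A assume A: "A \<in> sets N"
    have "traj_slice be (g -` A \<inter> space (trajS k))
        = (\<lambda>x. g (fst be, snd be, x)) -` A \<inter> space (trajM (fst be) (snd be))" if "be \<in> BE k" for be
      using that by (auto simp: traj_slice_def space_trajS traj_space_def)
    with g A show "g -` A \<inter> space (trajS k) \<in> sets (trajS k)"
      by (auto simp: sets_trajS traj_sets_def space_trajS intro: measurable_sets)
  qed
qed

lemma measurable_Pair_traj:
  assumes "(b, e) \<in> BE k"
  shows "(\<lambda>x. (b, e, x)) \<in> measurable (trajM b e) (trajS k)"
proof -
  have "(\<lambda>X. X) \<in> measurable (trajS k) (trajS k)" by (rule measurable_ident_sets) simp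
  from bspec[OF this[unfolded measurable_trajS_iff] assms] show ?thesis by simp
qed

lemma tint_cong_space:
  assumes "\<And>X. X \<in> traj_space k \<Longrightarrow> g X = g' X"
  shows "tint k g = tint k g'"
  unfolding tint_def
  by (intro sum.cong refl nn_integral_cong assms) (auto simp: traj_space_def)

text \<open>The two sides agree on indicators by \<open>emeasure_trajS\<close>. Both are additive,
  homogeneous and continuous along increasing sequences of measurable functions; for
  \<open>tint\<close> this is inherited from the finitely many components.\<close>

lemma nn_integral_trajS:
  assumes "g \<in> borel_measurable (trajS k)"
  shows "integral\<^sup>N (trajS k) g = tint k g"
  using assms
proof induction
  case (cong f g)
  then show ?case
    using tint_cong_space[of k f g] nn_integral_cong[of "trajS k" f g] by (simp add: space_trajS)
next
  case (set A)
  have "integral\<^sup>N (trajS k) (indicator A) = (\<Sum>be\<in>BE k. emeasure (trajM (fst be) (snd be)) (traj_slice be A))"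
    using set by (simp add: emeasure_trajS)
  also have "\<dots> = tint k (indicator A)"
    unfolding tint_def
  proof (rule sum.cong[OF refl])
    fix be assume "be \<in> BE k"
    with set have "traj_slice be A \<in> sets (trajM (fst be) (snd be))"
      by (auto simp: sets_trajS traj_sets_def)
    then have "emeasure (trajM (fst be) (snd be)) (traj_slice be A)
       = (\<integral>\<^sup>+x. indicator (traj_slice be A) x \<partial>trajM (fst be) (snd be))" by simp
    also have "\<dots> = (\<integral>\<^sup>+x. indicator A (fst be, snd be, x) \<partial>trajM (fst be) (snd be))"
      by (rule nn_integral_cong) (auto simp: traj_slice_def indicator_def)
    finally show "emeasure (trajM (fst be) (snd be)) (traj_slice be A) = \<dots>" .
  qed
  finally show ?case .
next
  case (mult u c)
  have m: "(\<lambda>x. u (fst be, snd be, x)) \<in> borel_measurable (trajM (fst be) (snd be))"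
    if "be \<in> BE k" for be
    using mult(2) that by (simp only: measurable_trajS_iff)
  have "(\<integral>\<^sup>+X. c * u X \<partial>trajS k) = c * tint k u"
    using mult by (simp only: nn_integral_cmult)
  also have "\<dots> = tint k (\<lambda>X. c * u X)"
    unfolding tint_def sum_distrib_left using m
    by (intro sum.cong refl nn_integral_cmult[symmetric])
  finally show ?case .
next
  case (add u v)
  have m: "(\<lambda>x. u (fst be, snd be, x)) \<in> borel_measurable (trajM (fst be) (snd be))"
    "(\<lambda>x. v (fst be, snd be, x)) \<in> borel_measurable (trajM (fst be) (snd be))"
    if "be \<in> BE k" for be
    using add that by (simp_all only: measurable_trajS_iff)
  have "(\<integral>\<^sup>+X. v X + u X \<partial>trajS k) = tint k v + tint k u"
    using add by (simp only: nn_integral_add)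
  also have "\<dots> = tint k (\<lambda>X. v X + u X)"
    unfolding tint_def sum.distrib[symmetric] using m
    by (intro sum.cong refl nn_integral_add[symmetric])
  finally show ?case .
next
  case (seq U)
  note inc = \<open>incseq U\<close> and meas = seq.hyps(1)
  have mono: "incseq (\<lambda>i x. U i (fst be, snd be, x))" for be
    using inc by (simp add: incseq_def le_fun_def)
  have S: "(SUP i. U i) X = (SUP i. U i X)" for X by (simp add: image_comp)
  have "integral\<^sup>N (trajS k) (SUP i. U i) = (\<integral>\<^sup>+X. (SUP i. U i X) \<partial>trajS k)"
    by (rule nn_integral_cong) (rule S)
  also have "\<dots> = (SUP i. integral\<^sup>N (trajS k) (U i))"
    by (rule nn_integral_monotone_convergence_SUP[OF inc meas])
  also have "\<dots> = (SUP i. tint k (U i))"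
    by (simp only: seq.IH)
  also have "\<dots> = (\<Sum>be\<in>BE k. SUP i. \<integral>\<^sup>+ x. U i (fst be, snd be, x) \<partial>trajM (fst be) (snd be))"
    unfolding tint_def
  proof (rule ennreal_SUP_sum)
    show "incseq (\<lambda>i. \<integral>\<^sup>+ x. U i (fst be, snd be, x) \<partial>trajM (fst be) (snd be))" for be
      by (rule incseq_SucI, rule nn_integral_mono) (use inc in \<open>simp add: incseq_Suc_iff le_fun_def\<close>)
  qed
  also have "\<dots> = (\<Sum>be\<in>BE k. \<integral>\<^sup>+ x. (SUP i. U i (fst be, snd be, x)) \<partial>trajM (fst be) (snd be))"
    by (intro sum.cong refl nn_integral_monotone_convergence_SUP[OF mono, symmetric])
      (use meas in \<open>simp add: measurable_trajS_iff\<close>)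
  also have "\<dots> = tint k (SUP i. U i)"
    unfolding tint_def by (intro sum.cong refl nn_integral_cong) (rule S[symmetric])
  finally show ?case using \<open>g = (SUP i. U i)\<close> by (simp only:)
qed

lemma product_sigma_finite_lborel: "product_sigma_finite (\<lambda>_. lborel)"
  by standard

lemma sigma_finite_trajM: "sigma_finite_measure (trajM b e)"
  unfolding trajM_def
  by (rule product_sigma_finite.sigma_finite[OF product_sigma_finite_lborel]) auto

text \<open>Each of the finitely many components has a countable cover by sets of finite measure.
  The images of these sets in the sum form a countable cover again.\<close>

lemma sigma_finite_trajS: "sigma_finite_measure (trajS k)"
proof -
  have "\<exists>A. countable A \<and> A \<subseteq> sets (trajM (fst be) (snd be) :: (nat \<Rightarrow> 'a) measure)
      \<and> \<Union>A = space (trajM (fst be) (snd be) :: (nat \<Rightarrow> 'a) measure)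
      \<and> (\<forall>a\<in>A. emeasure (trajM (fst be) (snd be)) a \<noteq> \<infinity>)" for be
    by (rule sigma_finite_measure.sigma_finite_countable[OF sigma_finite_trajM])
  then have "\<exists>A. \<forall>be. countable (A be) \<and> A be \<subseteq> sets (trajM (fst be) (snd be) :: (nat \<Rightarrow> 'a) measure)
      \<and> \<Union>(A be) = space (trajM (fst be) (snd be) :: (nat \<Rightarrow> 'a) measure)
      \<and> (\<forall>a\<in>A be. emeasure (trajM (fst be) (snd be)) a \<noteq> \<infinity>)"
    by (intro choice allI)
  then obtain A where AA: "\<forall>be. countable (A be) \<and> A be \<subseteq> sets (trajM (fst be) (snd be) :: (nat \<Rightarrow> 'a) measure)
      \<and> \<Union>(A be) = space (trajM (fst be) (snd be) :: (nat \<Rightarrow> 'a) measure)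
      \<and> (\<forall>a\<in>A be. emeasure (trajM (fst be) (snd be)) a \<noteq> \<infinity>)"
    by (rule exE)
  have A: "countable (A be)" "A be \<subseteq> sets (trajM (fst be) (snd be))"
    "\<Union>(A be) = space (trajM (fst be) (snd be))" for be
    using AA[rule_format, of be] by simp_all
  have A4: "emeasure (trajM (fst be) (snd be)) a \<noteq> \<infinity>" if "a \<in> A be" for be a
    using AA[rule_format, of be] that by simp
  define B where "B be a = (\<lambda>x::nat \<Rightarrow> 'a. (fst be, snd be, x)) ` a" for be :: "nat \<times> nat" and a
  \<comment> \<open>An image from one component has empty slices in all others, so it is measurable
    and keeps its measure.\<close>
  have sl: "traj_slice be' (B be a) = (if be' = be then a else {})" if "a \<in> A be" for be be' a
    using A(3)[of be] that by (auto simp: traj_slice_def B_def prod_eq_iff)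
  have BS: "B be a \<in> sets (trajS k)" if "be \<in> BE k" "a \<in> A be" for be a
  proof -
    have "B be a \<subseteq> traj_space k"
      using that A(3)[of be] by (auto simp: B_def traj_space_def)
    moreover have "a \<in> sets (trajM (fst be) (snd be))" using that(2) A(2)[of be] by blast
    ultimately show ?thesis
      using that by (auto simp: sets_trajS traj_sets_def sl)
  qed
  let ?C = "(\<Union>be\<in>BE k. B be ` A be)"
  have "countable ?C" using A(1) by (intro countable_UN) (auto intro: countable_finite)
  moreover have "?C \<subseteq> sets (trajS k)" using BS by auto
  moreover have "\<Union>?C = space (trajS k)"
  proof
    show "\<Union>?C \<subseteq> space (trajS k)" using sets.sets_into_space[OF BS] by blast
    show "space (trajS k) \<subseteq> \<Union>?C"
    proof
      fix X :: "'a traj" assume "X \<in> space (trajS k)"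
      then obtain b e x where X: "X = (b, e, x)" "(b, e) \<in> BE k" "x \<in> space (trajM b e)"
        by (auto simp: space_trajS traj_space_def)
      then obtain a where "a \<in> A (b, e)" "x \<in> a" using A(3)[of "(b, e)"] by auto
      with X(1) have "X \<in> B (b, e) a" by (simp add: B_def)
      with X(2) \<open>a \<in> A (b, e)\<close> show "X \<in> \<Union>?C" by blast
    qed
  qed
  moreover have "\<forall>c\<in>?C. emeasure (trajS k) c \<noteq> \<infinity>"
  proof safe
    fix be :: "nat \<times> nat" and a assume a: "be \<in> BE k" "a \<in> A be" "emeasure (trajS k) (B be a) = \<infinity>"
    have "emeasure (trajS k) (B be a)
        = (\<Sum>be'\<in>BE k. if be' = be then emeasure (trajM (fst be) (snd be)) a else 0)"
      unfolding emeasure_trajS[OF BS[OF a(1,2)]] using a(2) by (intro sum.cong) (auto simp: sl)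
    also have "\<dots> = emeasure (trajM (fst be) (snd be)) a" using a(1) by simp
    finally show False using A4[OF a(2)] a(3) by simp
  qed
  ultimately show ?thesis by (intro sigma_finite_measure.intro) blast
qed

section \<open>Types of trajectories and joint measurability\<close>

definition traj_type :: "'a traj \<Rightarrow> nat \<times> nat" where
  "traj_type X = (fst X, fst (snd X))"

text \<open>Off the component \<open>be\<close> the zero tuple serves as default. It is extensional
  on the interval of \<open>be\<close>, so the projection takes values in the space of
  \<open>trajM (fst be) (snd be)\<close> everywhere and is measurable on the whole sum.\<close>

definition traj_proj :: "nat \<times> nat \<Rightarrow> 'a::euclidean_space traj \<Rightarrow> nat \<Rightarrow> 'a" where
  "traj_proj be X = (if traj_type X = be then snd (snd X) else (\<lambda>i\<in>{fst be..snd be}. 0))"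

lemma measurable_traj_type [measurable]: "traj_type \<in> measurable (trajS k) (count_space UNIV)"
  unfolding measurable_trajS_iff by (simp add: traj_type_def)

lemma measurable_traj_proj [measurable]:
  "traj_proj be \<in> measurable (trajS k) (trajM (fst be) (snd be))"
  unfolding measurable_trajS_iff
proof
  fix be' :: "nat \<times> nat"
  show "(\<lambda>x. traj_proj be (fst be', snd be', x))
      \<in> measurable (trajM (fst be') (snd be')) (trajM (fst be) (snd be))"
    by (cases "be' = be") (auto simp: traj_proj_def traj_type_def trajM_def space_PiM)
qed

lemma traj_proj_eq: "traj_type X = be \<Longrightarrow> (fst be, snd be, traj_proj be X) = X"
  by (auto simp: traj_proj_def traj_type_def)

lemma traj_type_space: "X \<in> space (trajS k) \<Longrightarrow> traj_type X \<in> BE k"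
  by (auto simp: space_trajS traj_space_def traj_type_def)

text \<open>The componentwise criterion \<open>measurable_trajS_iff\<close> does not speak about
  products with a second factor. Here \<open>g\<close> is written as a case distinction over the
  type of its first argument, which is measurable with countable range; on each type,
  \<open>traj_proj\<close> makes the case a function on the whole product.\<close>

lemma measurable_trajS_pairI:
  assumes "\<And>b e. (b, e) \<in> BE k \<Longrightarrow> (\<lambda>(x, y). g ((b, e, x), y)) \<in> measurable (trajM b e \<Otimes>\<^sub>M L) N"
  shows "g \<in> measurable (trajS k \<Otimes>\<^sub>M L) N"
proof -
  let ?F = "\<lambda>be p. g ((fst be, snd be, traj_proj be (fst p)), snd p)"
  have "(\<lambda>p. ?F (traj_type (fst p)) p) \<in> measurable (trajS k \<Otimes>\<^sub>M L) N"
  proof (rule measurable_compose_countable'[where I = "BE k"])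
    fix be :: "nat \<times> nat" assume "be \<in> BE k"
    then have "(\<lambda>(x, y). g ((fst be, snd be, x), y)) \<in> measurable (trajM (fst be) (snd be) \<Otimes>\<^sub>M L) N"
      using assms[of "fst be" "snd be"] by simp
    from measurable_compose[OF _ this, of "\<lambda>p. (traj_proj be (fst p), snd p)" "trajS k \<Otimes>\<^sub>M L"]
    show "?F be \<in> measurable (trajS k \<Otimes>\<^sub>M L) N" by simp
  next
    have m: "(\<lambda>p. traj_type (fst p)) \<in> measurable (trajS k \<Otimes>\<^sub>M L) (count_space UNIV)" by measurable
    show "(\<lambda>p. traj_type (fst p)) \<in> measurable (trajS k \<Otimes>\<^sub>M L) (count_space (BE k))"
      by (rule measurableI) (use measurable_sets[OF m] in \<open>auto simp: space_pair_measure traj_type_space\<close>)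
  qed (auto intro: countable_finite)
  then show ?thesis by (simp add: traj_proj_eq)
qed

section \<open>Lists of points and Bernoulli operators\<close>

text \<open>Transporting the product along \<open>Cons\<close>, instead of indexing by positions,
  makes the recursion match that of \<open>mint\<close>: the first entry belongs to the outermost
  integral.\<close>

primrec listM :: "'b measure \<Rightarrow> nat \<Rightarrow> 'b list measure" where
  "listM M 0 = count_space {[]}"
| "listM M (Suc n) = embed_measure (M \<Otimes>\<^sub>M listM M n) (\<lambda>(x, xs). x # xs)"

lemma inj_Cons_pair: "inj (\<lambda>(x, xs). x # xs)"
  by (auto simp: inj_def)

lemma space_listM: "space (listM M n) = {xs. length xs = n \<and> set xs \<subseteq> space M}"
proof (induction n)
  case (Suc n)
  show ?case
  proof (intro set_eqI)
    fix xs
    show "xs \<in> space (listM M (Suc n)) \<longleftrightarrow> xs \<in> {xs. length xs = Suc n \<and> set xs \<subseteq> space M}"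
      by (cases xs) (auto simp: space_embed_measure space_pair_measure Suc)
  qed
qed auto

lemma sigma_finite_listM:
  assumes "sigma_finite_measure M"
  shows "sigma_finite_measure (listM M n)"
proof (induction n)
  case 0
  show ?case by (simp add: sigma_finite_measure_count_space_finite)
next
  case (Suc n)
  with assms interpret pair_sigma_finite M "listM M n" by (rule pair_sigma_finite.intro)
  have "sigma_finite_measure (M \<Otimes>\<^sub>M listM M n)" ..
  then show ?case by (simp add: sigma_finite_embed_measure inj_Cons_pair)
qed

lemma measurable_Cons_listM [measurable (raw)]:
  assumes "f \<in> measurable L M" "g \<in> measurable L (listM M n)"
  shows "(\<lambda>x. f x # g x) \<in> measurable L (listM M (Suc n))"
proof -
  have "(\<lambda>(x, xs). x # xs) \<in> measurable (M \<Otimes>\<^sub>M listM M n) (listM M (Suc n))"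
    using measurable_embed_measure2[OF inj_Cons_pair] by simp
  from measurable_compose[OF measurable_Pair[OF assms] this] show ?thesis by simp
qed

lemma measurable_listM_Suc_iff:
  "G \<in> measurable (listM M (Suc n)) N \<longleftrightarrow> (\<lambda>(x, xs). G (x # xs)) \<in> measurable (M \<Otimes>\<^sub>M listM M n) N"
proof
  assume G: "G \<in> measurable (listM M (Suc n)) N"
  have "(\<lambda>p. fst p # snd p) \<in> measurable (M \<Otimes>\<^sub>M listM M n) (listM M (Suc n))"
    by (intro measurable_Cons_listM measurable_fst measurable_snd)
  from measurable_compose[OF this G]
  show "(\<lambda>(x, xs). G (x # xs)) \<in> measurable (M \<Otimes>\<^sub>M listM M n) N"
    by (simp add: case_prod_beta')
next
  assume "(\<lambda>(x, xs). G (x # xs)) \<in> measurable (M \<Otimes>\<^sub>M listM M n) N"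
  then show "G \<in> measurable (listM M (Suc n)) N"
    by (auto intro!: measurable_embed_measure1 simp: case_prod_beta')
qed

lemma measurable_hd_listM [measurable]: "hd \<in> measurable (listM M (Suc n)) M"
  unfolding measurable_listM_Suc_iff by (simp add: case_prod_beta')

lemma measurable_tl_listM [measurable]: "tl \<in> measurable (listM M (Suc n)) (listM M n)"
  unfolding measurable_listM_Suc_iff by (simp add: case_prod_beta')

lemma measurable_nth_listM: "i < n \<Longrightarrow> (\<lambda>xs. xs ! i) \<in> measurable (listM M n) M"
proof (induction n arbitrary: i)
  case (Suc n)
  show ?case
  proof (cases i)
    case 0
    then show ?thesis unfolding measurable_listM_Suc_iff by (simp add: case_prod_beta')
  next
    case (Suc j)
    then have j: "j < n" using Suc.prems by simp
    show ?thesis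
      unfolding measurable_listM_Suc_iff Suc
      using measurable_compose[OF measurable_snd Suc.IH[OF j]]
      by (simp add: case_prod_beta')
  qed
qed simp

lemma listM_Suc_hd_tl: "xs \<in> space (listM M (Suc n)) \<Longrightarrow> hd xs # tl xs = xs"
  using space_listM[of M "Suc n"] by (cases xs) auto

text \<open>The version of \<open>measurable_listM_Suc_iff\<close> with a parameter: the list is
  taken apart by \<open>hd\<close> and \<open>tl\<close> while the parameter is carried
  along.\<close>

lemma measurable_pair_listM_SucI:
  assumes "(\<lambda>q. G (fst q, fst (snd q) # snd (snd q))) \<in> measurable (L \<Otimes>\<^sub>M (M \<Otimes>\<^sub>M listM M n)) N"
  shows "G \<in> measurable (L \<Otimes>\<^sub>M listM M (Suc n)) N"
proof -
  have "(\<lambda>q. (fst q, hd (snd q), tl (snd q)))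
      \<in> measurable (L \<Otimes>\<^sub>M listM M (Suc n)) (L \<Otimes>\<^sub>M (M \<Otimes>\<^sub>M listM M n))"
    by (intro measurable_Pair measurable_fst
          measurable_compose[OF measurable_snd measurable_hd_listM]
          measurable_compose[OF measurable_snd measurable_tl_listM])
  from measurable_compose[OF this assms]
  have "(\<lambda>q. G (fst q, hd (snd q) # tl (snd q))) \<in> measurable (L \<Otimes>\<^sub>M listM M (Suc n)) N" by simp
  then show ?thesis
    by (rule measurable_cong[THEN iffD1, rotated])
      (auto simp: space_pair_measure intro!: arg_cong[where f = G] listM_Suc_hd_tl)
qed

lemma nn_integral_listM_0 [simp]: "(\<integral>\<^sup>+xs. G xs \<partial>listM M 0) = G []"
  by (simp add: nn_integral_count_space_finite)

lemma nn_integral_listM_Suc: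
  assumes "sigma_finite_measure M" "G \<in> borel_measurable (listM M (Suc n))"
  shows "(\<integral>\<^sup>+xs. G xs \<partial>listM M (Suc n)) = (\<integral>\<^sup>+x. (\<integral>\<^sup>+xs. G (x # xs) \<partial>listM M n) \<partial>M)"
proof -
  interpret sigma_finite_measure "listM M n" by (rule sigma_finite_listM[OF assms(1)])
  have "(\<integral>\<^sup>+xs. G xs \<partial>listM M (Suc n)) = (\<integral>\<^sup>+p. (\<lambda>(x, xs). G (x # xs)) p \<partial>(M \<Otimes>\<^sub>M listM M n))"
    using nn_integral_embed_measure[OF inj_Cons_pair, of G "M \<Otimes>\<^sub>M listM M n"] assms(2)
    by (simp add: case_prod_beta')
  also have "\<dots> = (\<integral>\<^sup>+x. (\<integral>\<^sup>+xs. G (x # xs) \<partial>listM M n) \<partial>M)"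
    using assms(2) unfolding measurable_listM_Suc_iff by (subst nn_integral_fst[symmetric]) simp_all
  finally show ?thesis .
qed

section \<open>Bernoulli operators and their commutation\<close>

definition list_meas :: "'b measure \<Rightarrow> ('b list \<Rightarrow> ennreal) \<Rightarrow> bool" where
  "list_meas M G \<longleftrightarrow> (\<forall>n. G \<in> borel_measurable (listM M n))"

text \<open>Symmetry is restricted to lists over \<open>S\<close> because for the survival fold it
  comes from Fubini, whose measurability conditions hold for trajectories inside the trajectory
  space.\<close>

definition perm_inv :: "'b set \<Rightarrow> ('b list \<Rightarrow> ennreal) \<Rightarrow> bool" where
  "perm_inv S G \<longleftrightarrow> (\<forall>xs ys. mset xs = mset ys \<longrightarrow> set xs \<subseteq> S \<longrightarrow> G xs = G ys)"

text \<open>With probability \<open>p\<close> a random point is put in front of the list. Its law is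
  the image under \<open>g\<close> of the density \<open>u\<close> on \<open>L\<close>, not a
  density on the point space itself; this covers both a new trajectory (\<open>g\<close> the
  identity) and survival, where only the new final state is random and the Dirac part of the
  transition is absorbed into \<open>g\<close>.\<close>

definition bernoulli_op :: "ennreal \<Rightarrow> ennreal \<Rightarrow> 'c measure \<Rightarrow> ('c \<Rightarrow> ennreal) \<Rightarrow> ('c \<Rightarrow> 'b)
    \<Rightarrow> ('b list \<Rightarrow> ennreal) \<Rightarrow> 'b list \<Rightarrow> ennreal" where
  "bernoulli_op c p L u g G zs = c * G zs + p * (\<integral>\<^sup>+y. u y * G (g y # zs) \<partial>L)"

lemma list_measD: "list_meas M G \<Longrightarrow> G \<in> borel_measurable (listM M n)"
  by (simp add: list_meas_def)

lemma list_meas_Cons: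
  assumes "list_meas M G" "g \<in> measurable L M" "h \<in> measurable L (listM M n)"
  shows "(\<lambda>x. G (g x # h x)) \<in> borel_measurable L"
  using measurable_compose[OF measurable_Cons_listM[OF assms(2,3)] list_measD[OF assms(1)]] .

lemma list_meas_Cons_const:
  assumes "list_meas M G" "g \<in> measurable L M" "set zs \<subseteq> space M"
  shows "(\<lambda>x. G (g x # zs)) \<in> borel_measurable L"
  by (rule list_meas_Cons[OF assms(1,2), where n = "length zs"])
    (use assms(3) in \<open>simp add: space_listM\<close>)

lemma bernoulli_op_list_meas:
  assumes "sigma_finite_measure L" "u \<in> borel_measurable L" "g \<in> measurable L M" "list_meas M G"
  shows "list_meas M (bernoulli_op c p L u g G)"
  unfolding list_meas_def
proof
  fix n
  interpret sigma_finite_measure L by fact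
  have "(\<lambda>q. G (g (snd q) # fst q)) \<in> borel_measurable (listM M n \<Otimes>\<^sub>M L)"
    by (intro list_meas_Cons[OF assms(4), where n = n] measurable_compose[OF measurable_snd assms(3)] measurable_fst)
  then have "(\<lambda>zs. \<integral>\<^sup>+y. u y * G (g y # zs) \<partial>L) \<in> borel_measurable (listM M n)"
    using assms(2) by (intro borel_measurable_nn_integral) (simp add: case_prod_beta')
  with list_measD[OF assms(4)] show "bernoulli_op c p L u g G \<in> borel_measurable (listM M n)"
    unfolding bernoulli_op_def by measurable
qed

lemma bernoulli_op_perm_inv:
  assumes "g \<in> space L \<rightarrow> S" "perm_inv S G"
  shows "perm_inv S (bernoulli_op c p L u g G)"
  unfolding perm_inv_def
proof (intro allI impI)
  fix xs ys assume *: "mset xs = mset ys" "set xs \<subseteq> S"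
  then have "G xs = G ys" using assms(2) by (simp add: perm_inv_def)
  moreover have "(\<integral>\<^sup>+y. u y * G (g y # xs) \<partial>L) = (\<integral>\<^sup>+y. u y * G (g y # ys) \<partial>L)"
  proof (rule nn_integral_cong)
    fix y assume "y \<in> space L"
    with assms(1) * have "mset (g y # xs) = mset (g y # ys)" "set (g y # xs) \<subseteq> S" by auto
    with assms(2) have "G (g y # xs) = G (g y # ys)" unfolding perm_inv_def by blast
    then show "u y * G (g y # xs) = u y * G (g y # ys)" by simp
  qed
  ultimately show "bernoulli_op c p L u g G xs = bernoulli_op c p L u g G ys" by (simp add: bernoulli_op_def)
qed

lemma bernoulli_op_cong:
  assumes "g \<in> space L \<rightarrow> S" "set zs \<subseteq> S" "\<And>zs. set zs \<subseteq> S \<Longrightarrow> G zs = G' zs"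
  shows "bernoulli_op c p L u g G zs = bernoulli_op c p L u g G' zs"
proof -
  have "(\<integral>\<^sup>+y. u y * G (g y # zs) \<partial>L) = (\<integral>\<^sup>+y. u y * G' (g y # zs) \<partial>L)"
    using assms(1,2) by (intro nn_integral_cong arg_cong2[where f = times] refl assms(3)) auto
  with assms(2,3) show ?thesis by (simp add: bernoulli_op_def)
qed

text \<open>Both sides expand into four terms. Only the double integrals differ: in the order of
  integration, handled by Fubini, and in the order of the two inserted points, handled by
  \<open>perm_inv\<close>.\<close>

lemma bernoulli_op_commute:
  assumes L: "sigma_finite_measure L" "u \<in> borel_measurable L" "g \<in> measurable L M"
    and L': "sigma_finite_measure L'" "u' \<in> borel_measurable L'" "g' \<in> measurable L' M"
    and G: "list_meas M G" "perm_inv (space M) G" and zs: "set zs \<subseteq> space M"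
  shows "bernoulli_op c p L u g (bernoulli_op c' p' L' u' g' G) zs = bernoulli_op c' p' L' u' g' (bernoulli_op c p L u g G) zs"
proof -
  interpret L: sigma_finite_measure L by fact
  interpret L': sigma_finite_measure L' by fact
  interpret LL: pair_sigma_finite L L' ..
  have zsM: "(\<lambda>_. zs) \<in> measurable N (listM M (length zs))" for N :: "'z measure"
    using zs by (simp add: space_listM)
  have m1 [measurable]: "(\<lambda>y. G (g y # zs)) \<in> borel_measurable L"
    by (rule list_meas_Cons_const[OF G(1) L(3) zs])
  have m1' [measurable]: "(\<lambda>y. G (g' y # zs)) \<in> borel_measurable L'"
    by (rule list_meas_Cons_const[OF G(1) L'(3) zs])
  have m2: "(\<lambda>q. G (g' (snd q) # g (fst q) # zs)) \<in> borel_measurable (L \<Otimes>\<^sub>M L')"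
    using zs
    by (intro list_meas_Cons[OF G(1), where n = "Suc (length zs)"] measurable_Cons_listM
          measurable_compose[OF measurable_fst L(3)] measurable_compose[OF measurable_snd L'(3)])
      (simp add: space_listM)
  note [measurable] = L(2) L'(2)
  have m3 [measurable]: "(\<lambda>y. \<integral>\<^sup>+y'. u' y' * G (g' y' # g y # zs) \<partial>L') \<in> borel_measurable L"
    using m2 by (intro L'.borel_measurable_nn_integral) (simp add: case_prod_beta')
  have m3' [measurable]: "(\<lambda>y'. \<integral>\<^sup>+y. u y * G (g y # g' y' # zs) \<partial>L) \<in> borel_measurable L'"
  proof (intro L.borel_measurable_nn_integral)
    have "(\<lambda>q. G (g (snd q) # g' (fst q) # zs)) \<in> borel_measurable (L' \<Otimes>\<^sub>M L)"
      using zs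
      by (intro list_meas_Cons[OF G(1), where n = "Suc (length zs)"] measurable_Cons_listM
            measurable_compose[OF measurable_fst L'(3)] measurable_compose[OF measurable_snd L(3)])
        (simp add: space_listM)
    then show "(\<lambda>(y', y). u y * G (g y # g' y' # zs)) \<in> borel_measurable (L' \<Otimes>\<^sub>M L)"
      by (simp add: case_prod_beta')
  qed
  have m4: "(\<lambda>y'. G (g' y' # g y # zs)) \<in> borel_measurable L'" if "y \<in> space L" for y
    using zs that measurable_space[OF L(3)]
    by (intro list_meas_Cons_const[OF G(1) L'(3)]) auto
  have m4': "(\<lambda>y. G (g y # g' y' # zs)) \<in> borel_measurable L" if "y' \<in> space L'" for y'
    using zs that measurable_space[OF L'(3)]
    by (intro list_meas_Cons_const[OF G(1) L(3)]) auto
  have dbl: "(\<integral>\<^sup>+y. u y * (\<integral>\<^sup>+y'. u' y' * G (g' y' # g y # zs) \<partial>L') \<partial>L)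
      = (\<integral>\<^sup>+y'. u' y' * (\<integral>\<^sup>+y. u y * G (g y # g' y' # zs) \<partial>L) \<partial>L')"
  proof -
    have "(\<integral>\<^sup>+y. u y * (\<integral>\<^sup>+y'. u' y' * G (g' y' # g y # zs) \<partial>L') \<partial>L)
        = (\<integral>\<^sup>+y. (\<integral>\<^sup>+y'. u y * (u' y' * G (g' y' # g y # zs)) \<partial>L') \<partial>L)"
      by (intro nn_integral_cong nn_integral_cmult[symmetric] borel_measurable_times_ennreal L'(2) m4)
    also have "\<dots> = (\<integral>\<^sup>+y'. (\<integral>\<^sup>+y. u y * (u' y' * G (g' y' # g y # zs)) \<partial>L) \<partial>L')"
      using m2 by (intro LL.Fubini'[symmetric]) (simp add: case_prod_beta')
    also have "\<dots> = (\<integral>\<^sup>+y'. (\<integral>\<^sup>+y. u' y' * (u y * G (g y # g' y' # zs)) \<partial>L) \<partial>L')"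
    proof (intro nn_integral_cong)
      fix y y' assume "y \<in> space L" "y' \<in> space L'"
      then have "set (g' y' # g y # zs) \<subseteq> space M"
        using zs measurable_space[OF L(3)] measurable_space[OF L'(3)] by auto
      moreover have "mset (g' y' # g y # zs) = mset (g y # g' y' # zs)" by simp
      ultimately have "G (g' y' # g y # zs) = G (g y # g' y' # zs)"
        using G(2) unfolding perm_inv_def by blast
      then show "u y * (u' y' * G (g' y' # g y # zs)) = u' y' * (u y * G (g y # g' y' # zs))"
        by (simp add: ac_simps)
    qed
    also have "\<dots> = (\<integral>\<^sup>+y'. u' y' * (\<integral>\<^sup>+y. u y * G (g y # g' y' # zs) \<partial>L) \<partial>L')"
      by (intro nn_integral_cong nn_integral_cmult borel_measurable_times_ennreal L(2) m4')
    finally show ?thesis .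
  qed
  have e1: "(\<integral>\<^sup>+y. u y * bernoulli_op c' p' L' u' g' G (g y # zs) \<partial>L)
      = c' * (\<integral>\<^sup>+y. u y * G (g y # zs) \<partial>L)
        + p' * (\<integral>\<^sup>+y. u y * (\<integral>\<^sup>+y'. u' y' * G (g' y' # g y # zs) \<partial>L') \<partial>L)"
  proof -
    have "(\<integral>\<^sup>+y. u y * bernoulli_op c' p' L' u' g' G (g y # zs) \<partial>L)
        = (\<integral>\<^sup>+y. c' * (u y * G (g y # zs))
            + p' * (u y * (\<integral>\<^sup>+y'. u' y' * G (g' y' # g y # zs) \<partial>L')) \<partial>L)"
      by (simp add: bernoulli_op_def distrib_left ac_simps)
    then show ?thesis by (simp add: nn_integral_add nn_integral_cmult)
  qed
  have e2: "(\<integral>\<^sup>+y. u' y * bernoulli_op c p L u g G (g' y # zs) \<partial>L')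
      = c * (\<integral>\<^sup>+y. u' y * G (g' y # zs) \<partial>L')
        + p * (\<integral>\<^sup>+y'. u' y' * (\<integral>\<^sup>+y. u y * G (g y # g' y' # zs) \<partial>L) \<partial>L')"
  proof -
    have "(\<integral>\<^sup>+y. u' y * bernoulli_op c p L u g G (g' y # zs) \<partial>L')
        = (\<integral>\<^sup>+y'. c * (u' y' * G (g' y' # zs))
            + p * (u' y' * (\<integral>\<^sup>+y. u y * G (g y # g' y' # zs) \<partial>L)) \<partial>L')"
      by (simp add: bernoulli_op_def distrib_left ac_simps)
    then show ?thesis by (simp add: nn_integral_add nn_integral_cmult)
  qed
  have "bernoulli_op c p L u g (bernoulli_op c' p' L' u' g' G) zs
      = c * bernoulli_op c' p' L' u' g' G zs + p * (\<integral>\<^sup>+y. u y * bernoulli_op c' p' L' u' g' G (g y # zs) \<partial>L)"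
    by (rule bernoulli_op_def)
  also have "\<dots> = c' * bernoulli_op c p L u g G zs + p' * (\<integral>\<^sup>+y. u' y * bernoulli_op c p L u g G (g' y # zs) \<partial>L')"
    unfolding e1 e2 dbl by (simp add: bernoulli_op_def distrib_left ac_simps)
  also have "\<dots> = bernoulli_op c' p' L' u' g' (bernoulli_op c p L u g G) zs"
    by (rule bernoulli_op_def[symmetric])
  finally show ?thesis .
qed

section \<open>List integrals of multi-Bernoulli densities\<close>

declare listM.simps(2) [simp del]

text \<open>\<open>pick_sum xs h\<close> sums \<open>h x ys\<close> over all ways of splitting \<open>xs\<close> into one entry \<open>x\<close> and the remaining list \<open>ys\<close>.\<close>
primrec pick_sum :: "'b list \<Rightarrow> ('b \<Rightarrow> 'b list \<Rightarrow> ennreal) \<Rightarrow> ennreal" where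
  "pick_sum [] h = 0"
| "pick_sum (x # xs) h = h x xs + pick_sum xs (\<lambda>y ys. h y (x # ys))"

text \<open>The premise retains that a split is a rearrangement of \<open>xs\<close>. This is how
  symmetry of a function, or distinctness of the list, becomes available for the summands.\<close>

lemma pick_sum_cong:
  assumes "\<And>y ys. mset (y # ys) = mset xs \<Longrightarrow> h y ys = h' y ys"
  shows "pick_sum xs h = pick_sum xs h'"
  using assms
proof (induction xs arbitrary: h h')
  case (Cons x xs)
  have "pick_sum xs (\<lambda>y ys. h y (x # ys)) = pick_sum xs (\<lambda>y ys. h' y (x # ys))"
    by (rule Cons.IH) (auto intro!: Cons.prems)
  with Cons.prems[of x xs] show ?case by simp
qed simp

lemma pick_sum_mult_const: "c * pick_sum xs h = pick_sum xs (\<lambda>y ys. c * h y ys)"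
  by (induction xs arbitrary: h) (simp_all add: distrib_left)

lemma pick_sum_mult_perm_inv:
  assumes "perm_inv S G" "set xs \<subseteq> S"
  shows "G xs * pick_sum xs h = pick_sum xs (\<lambda>y ys. G (y # ys) * h y ys)"
  unfolding pick_sum_mult_const
proof (rule pick_sum_cong)
  fix y ys assume "mset (y # ys) = mset xs"
  then have "mset xs = mset (y # ys)" by simp
  with assms have "G xs = G (y # ys)" unfolding perm_inv_def by blast
  then show "G xs * h y ys = G (y # ys) * h y ys" by simp
qed

text \<open>In a distinct list, dropping the picked entry removes the element from the underlying
  set, so splits of the list correspond to elements of the set.\<close>

lemma pick_sum_distinct:
  assumes "distinct xs"
  shows "pick_sum xs (\<lambda>x ys. g x (set ys)) = (\<Sum>x\<in>set xs. g x (set xs - {x}))"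
  using assms
proof (induction xs arbitrary: g)
  case (Cons x xs)
  have "pick_sum xs (\<lambda>y ys. g y (insert x (set ys))) = (\<Sum>y\<in>set xs. g y (insert x (set xs - {y})))"
    using Cons.IH[of "\<lambda>y Y. g y (insert x Y)"] Cons.prems by simp
  also have "\<dots> = (\<Sum>y\<in>set xs. g y (insert x (set xs) - {y}))"
    using Cons.prems by (intro sum.cong refl arg_cong[where f = "g _"]) auto
  finally show ?case using Cons.prems by simp
qed simp

text \<open>In the recursion of \<open>pick_sum\<close> the function \<open>h\<close> changes with
  every entry passed over. To keep joint measurability inductive, the passed entries are collected
  in a parameter list, whose length \<open>m\<close> grows by one in each step.\<close>

lemma measurable_pick_sum_aux:
  assumes "\<And>k. (\<lambda>q. h (fst q) (fst (snd q)) (snd (snd q)))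
      \<in> borel_measurable (listM M m \<Otimes>\<^sub>M (M \<Otimes>\<^sub>M listM M k))"
  shows "(\<lambda>q. pick_sum (snd q) (h (fst q))) \<in> borel_measurable (listM M m \<Otimes>\<^sub>M listM M n)"
  using assms
proof (induction n arbitrary: m h)
  case 0
  have "(\<lambda>q. 0) \<in> borel_measurable (listM M m \<Otimes>\<^sub>M listM M 0)" by simp
  then show ?case
    by (rule measurable_cong[THEN iffD1, rotated]) (auto simp: space_pair_measure)
next
  case (Suc n)
  let ?L = "listM M m \<Otimes>\<^sub>M (M \<Otimes>\<^sub>M listM M n)"
  \<comment> \<open>The parameter list works as a stack: its head is the entry just passed over,
    which returns to the remaining list before \<open>h\<close> is applied.\<close>
  let ?h = "\<lambda>q y ys. h (tl q) y (hd q # ys)"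
  have 1: "(\<lambda>q. h (fst q) (fst (snd q)) (snd (snd q))) \<in> borel_measurable ?L"
    by (rule Suc.prems)
  have "(\<lambda>q. ?h (fst q) (fst (snd q)) (snd (snd q)))
      \<in> borel_measurable (listM M (Suc m) \<Otimes>\<^sub>M (M \<Otimes>\<^sub>M listM M k))" for k
  proof -
    have "(\<lambda>q. (tl (fst q), fst (snd q), hd (fst q) # snd (snd q)))
        \<in> measurable (listM M (Suc m) \<Otimes>\<^sub>M (M \<Otimes>\<^sub>M listM M k)) (listM M m \<Otimes>\<^sub>M (M \<Otimes>\<^sub>M listM M (Suc k)))"
      by (intro measurable_Pair measurable_Cons_listM measurable_compose[OF measurable_fst measurable_tl_listM]
          measurable_compose[OF measurable_fst measurable_hd_listM] measurable_fst
          measurable_compose[OF measurable_snd measurable_fst] measurable_compose[OF measurable_snd measurable_snd])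
    from measurable_compose[OF this Suc.prems[of "Suc k"]] show ?thesis by simp
  qed
  then have ih: "(\<lambda>q. pick_sum (snd q) (?h (fst q))) \<in> borel_measurable (listM M (Suc m) \<Otimes>\<^sub>M listM M n)"
    by (rule Suc.IH)
  have "(\<lambda>q. (fst (snd q) # fst q, snd (snd q))) \<in> measurable ?L (listM M (Suc m) \<Otimes>\<^sub>M listM M n)"
    by (intro measurable_Pair measurable_Cons_listM measurable_fst
        measurable_compose[OF measurable_snd measurable_fst] measurable_compose[OF measurable_snd measurable_snd])
  from measurable_compose[OF this ih]
  have 2: "(\<lambda>q. pick_sum (snd (snd q)) (\<lambda>y ys. h (fst q) y (fst (snd q) # ys))) \<in> borel_measurable ?L"
    by simp
  show ?case
    by (rule measurable_pair_listM_SucI) (use 1 2 in simp)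
qed

lemma list_meas_pick_sum:
  assumes "\<And>k. (\<lambda>q. h (fst q) (snd q)) \<in> borel_measurable (M \<Otimes>\<^sub>M listM M k)"
  shows "list_meas M (\<lambda>xs. pick_sum xs h)"
  unfolding list_meas_def
proof
  fix n
  have "(\<lambda>q. h (fst (snd q)) (snd (snd q))) \<in> borel_measurable (listM M 0 \<Otimes>\<^sub>M (M \<Otimes>\<^sub>M listM M k))" for k
    using measurable_compose[OF measurable_snd assms[of k]] by simp
  then have *: "(\<lambda>q. pick_sum (snd q) h) \<in> borel_measurable (listM M 0 \<Otimes>\<^sub>M listM M n)"
    by (rule measurable_pick_sum_aux)
  have "(\<lambda>xs. ([], xs)) \<in> measurable (listM M n) (listM M 0 \<Otimes>\<^sub>M listM M n)"
    by (intro measurable_Pair measurable_ident_sets refl) simp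
  from measurable_compose[OF this *] show "(\<lambda>xs. pick_sum xs h) \<in> borel_measurable (listM M n)" by simp
qed

text \<open>Each of the \<open>Suc n\<close> positions of the picked entry contributes the same
  integral, because Fubini moves the picked entry past those in front of it.\<close>

lemma nn_integral_pick_sum:
  assumes M: "sigma_finite_measure M"
    and h: "\<And>k. (\<lambda>q. h (fst q) (snd q)) \<in> borel_measurable (M \<Otimes>\<^sub>M listM M k)"
  shows "(\<integral>\<^sup>+xs. pick_sum xs h \<partial>listM M (Suc n)) = of_nat (Suc n) * (\<integral>\<^sup>+ys. (\<integral>\<^sup>+x. h x ys \<partial>M) \<partial>listM M n)"
  using h
proof (induction n arbitrary: h)
  case 0
  have "(\<lambda>xs. pick_sum xs h) \<in> borel_measurable (listM M (Suc 0))"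
    using list_meas_pick_sum[OF 0] list_measD by blast
  then show ?case
    by (subst nn_integral_listM_Suc[OF M]) (simp_all only: nn_integral_listM_0, simp_all)
next
  case (Suc n)
  interpret M: sigma_finite_measure M by fact
  interpret L: sigma_finite_measure "listM M (Suc n)" by (rule sigma_finite_listM[OF M])
  interpret LL: pair_sigma_finite M "listM M (Suc n)" ..
  let ?h = "\<lambda>x y ys. h y (x # ys)"
  have pick_sum_m: "(\<lambda>xs. pick_sum xs h) \<in> borel_measurable (listM M k)" for k
    using list_meas_pick_sum[OF Suc.prems] list_measD by blast
  have hm: "(\<lambda>xs. h x xs) \<in> borel_measurable (listM M k)" if "x \<in> space M" for x k
    using measurable_compose[OF measurable_Pair1'[OF that] Suc.prems[of k]] by simp
  have h'm: "(\<lambda>q. ?h x (fst q) (snd q)) \<in> borel_measurable (M \<Otimes>\<^sub>M listM M k)" if "x \<in> space M" for x k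
  proof -
    have "(\<lambda>q. (fst q, x # snd q)) \<in> measurable (M \<Otimes>\<^sub>M listM M k) (M \<Otimes>\<^sub>M listM M (Suc k))"
      using that by (intro measurable_Pair measurable_Cons_listM measurable_fst measurable_snd measurable_const)
    from measurable_compose[OF this Suc.prems[of "Suc k"]] show ?thesis by simp
  qed
  have pick_sum_m': "(\<lambda>xs. pick_sum xs (?h x)) \<in> borel_measurable (listM M k)" if "x \<in> space M" for x k
    using list_meas_pick_sum[OF h'm[OF that]] list_measD by blast
  have hI: "(\<lambda>ys. \<integral>\<^sup>+y. h y ys \<partial>M) \<in> borel_measurable (listM M (Suc n))"
  proof (rule M.borel_measurable_nn_integral)
    have "(\<lambda>q. (snd q, fst q)) \<in> measurable (listM M (Suc n) \<Otimes>\<^sub>M M) (M \<Otimes>\<^sub>M listM M (Suc n))"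
      by (intro measurable_Pair measurable_fst measurable_snd)
    from measurable_compose[OF this Suc.prems[of "Suc n"]]
    show "(\<lambda>(ys, y). h y ys) \<in> borel_measurable (listM M (Suc n) \<Otimes>\<^sub>M M)"
      by (simp add: case_prod_beta')
  qed
  have "(\<integral>\<^sup>+xs. pick_sum xs h \<partial>listM M (Suc (Suc n)))
      = (\<integral>\<^sup>+x. (\<integral>\<^sup>+xs. pick_sum (x # xs) h \<partial>listM M (Suc n)) \<partial>M)"
    by (rule nn_integral_listM_Suc[OF M pick_sum_m])
  also have "\<dots> = (\<integral>\<^sup>+x. (\<integral>\<^sup>+xs. h x xs \<partial>listM M (Suc n)) + (\<integral>\<^sup>+xs. pick_sum xs (?h x) \<partial>listM M (Suc n)) \<partial>M)"
    by (intro nn_integral_cong) (simp only: pick_sum.simps nn_integral_add[OF hm pick_sum_m'])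
  also have "\<dots> = (\<integral>\<^sup>+x. (\<integral>\<^sup>+xs. h x xs \<partial>listM M (Suc n))
      + of_nat (Suc n) * (\<integral>\<^sup>+ys. (\<integral>\<^sup>+y. h y (x # ys) \<partial>M) \<partial>listM M n) \<partial>M)"
    by (intro nn_integral_cong arg_cong2[where f = plus] refl Suc.IH h'm)
  also have "\<dots> = (\<integral>\<^sup>+x. (\<integral>\<^sup>+xs. h x xs \<partial>listM M (Suc n)) \<partial>M)
      + of_nat (Suc n) * (\<integral>\<^sup>+x. (\<integral>\<^sup>+ys. (\<integral>\<^sup>+y. h y (x # ys) \<partial>M) \<partial>listM M n) \<partial>M)"
  proof -
    have 1: "(\<lambda>x. \<integral>\<^sup>+xs. h x xs \<partial>listM M (Suc n)) \<in> borel_measurable M"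
      by (rule L.borel_measurable_nn_integral) (use Suc.prems in \<open>simp add: case_prod_beta'\<close>)
    interpret L': sigma_finite_measure "listM M n" by (rule sigma_finite_listM[OF M])
    have 2: "(\<lambda>x. \<integral>\<^sup>+ys. (\<integral>\<^sup>+y. h y (x # ys) \<partial>M) \<partial>listM M n) \<in> borel_measurable M"
      by (rule L'.borel_measurable_nn_integral) (use hI in \<open>simp add: measurable_listM_Suc_iff\<close>)
    show ?thesis
      by (subst nn_integral_add) (use 1 2 in \<open>simp_all add: nn_integral_cmult\<close>)
  qed
  \<comment> \<open>Picking the first entry and picking a later one now become the same integral:
    one copy from the head plus \<open>Suc n\<close> copies from the induction hypothesis.\<close>
  also have "(\<integral>\<^sup>+x. (\<integral>\<^sup>+xs. h x xs \<partial>listM M (Suc n)) \<partial>M)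
      = (\<integral>\<^sup>+xs. (\<integral>\<^sup>+x. h x xs \<partial>M) \<partial>listM M (Suc n))"
    by (rule LL.Fubini'[symmetric]) (use Suc.prems in \<open>simp add: case_prod_beta'\<close>)
  also have "(\<integral>\<^sup>+x. (\<integral>\<^sup>+ys. (\<integral>\<^sup>+y. h y (x # ys) \<partial>M) \<partial>listM M n) \<partial>M)
      = (\<integral>\<^sup>+xs. (\<integral>\<^sup>+y. h y xs \<partial>M) \<partial>listM M (Suc n))"
    by (rule nn_integral_listM_Suc[OF M hI, symmetric])
  finally show ?case by (simp add: algebra_simps)
qed

text \<open>The counterpart of \<open>setintL\<close> with one measure on lists of each length in
  place of iterated integrals, so that linearity and Fubini apply. The two agree on measurable
  functions by \<open>setintL_eq_lsetint\<close>.\<close>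

definition lsetint :: "'b measure \<Rightarrow> ('b list \<Rightarrow> ennreal) \<Rightarrow> ennreal" where
  "lsetint M G = (\<Sum>n. (\<integral>\<^sup>+xs. G xs \<partial>listM M n) / of_nat (fact n))"

lemma lsetint_add:
  assumes "list_meas M F" "list_meas M G"
  shows "lsetint M (\<lambda>xs. F xs + G xs) = lsetint M F + lsetint M G"
  unfolding lsetint_def using assms
  by (simp add: list_measD nn_integral_add add_divide_distrib_ennreal suminf_add[symmetric] summableI)

lemma lsetint_cmult:
  assumes "list_meas M G"
  shows "lsetint M (\<lambda>xs. c * G xs) = c * lsetint M G"
  unfolding lsetint_def using assms
  by (simp add: list_measD nn_integral_cmult ennreal_suminf_cmult ennreal_times_divide[symmetric])

lemma lsetint_cong:
  assumes "\<And>xs. set xs \<subseteq> space M \<Longrightarrow> F xs = G xs"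
  shows "lsetint M F = lsetint M G"
proof -
  have "(\<integral>\<^sup>+xs. F xs \<partial>listM M n) = (\<integral>\<^sup>+xs. G xs \<partial>listM M n)" for n
    by (rule nn_integral_cong) (simp add: space_listM assms)
  then show ?thesis by (simp add: lsetint_def)
qed

lemma lsetint_sum:
  assumes "finite A" "\<And>a. a \<in> A \<Longrightarrow> list_meas M (F a)"
  shows "lsetint M (\<lambda>xs. \<Sum>a\<in>A. F a xs) = (\<Sum>a\<in>A. lsetint M (F a))"
  using assms
proof (induction rule: finite_induct)
  case empty
  show ?case by (simp add: lsetint_def)
next
  case (insert a A)
  have "list_meas M (\<lambda>xs. \<Sum>a\<in>A. F a xs)"
    using insert.prems by (auto simp: list_meas_def intro!: borel_measurable_sum)
  with insert show ?case by (simp add: lsetint_add)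
qed

text \<open>A Mecke-type identity for the set integral: summing over a distinguished point equals
  integrating over an extra point. The factor \<open>Suc n\<close> from the choice of position turns
  \<open>1 / fact (Suc n)\<close> into \<open>1 / fact n\<close>; the term for the empty list
  vanishes, so the series may be shifted by one.\<close>

lemma lsetint_pick_sum:
  assumes M: "sigma_finite_measure M"
    and h: "\<And>k. (\<lambda>q. h (fst q) (snd q)) \<in> borel_measurable (M \<Otimes>\<^sub>M listM M k)"
  shows "lsetint M (\<lambda>xs. pick_sum xs h) = lsetint M (\<lambda>ys. \<integral>\<^sup>+x. h x ys \<partial>M)"
proof -
  have "(of_nat (Suc n) * x :: ennreal) / of_nat (fact (Suc n)) = x / of_nat (fact n)" for n x
  proof -
    have "(of_nat (Suc n) * x :: ennreal) / of_nat (fact (Suc n))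
        = (x * of_nat (Suc n)) / (of_nat (fact n) * of_nat (Suc n))"
      by (simp only: fact_Suc of_nat_mult of_nat_id mult.commute)
    also have "\<dots> = x / of_nat (fact n)"
      by (rule divide_mult_eq) (simp_all add: ennreal_of_nat_eq_real_of_nat del: of_nat_Suc)
    finally show ?thesis .
  qed
  then have "(\<Sum>n. (\<integral>\<^sup>+xs. pick_sum xs h \<partial>listM M (Suc n)) / of_nat (fact (Suc n)))
      = lsetint M (\<lambda>ys. \<integral>\<^sup>+x. h x ys \<partial>M)"
    unfolding lsetint_def by (simp only: nn_integral_pick_sum[OF M h])
  then show ?thesis
    unfolding lsetint_def[of M "\<lambda>xs. pick_sum xs h"]
    by (subst suminf_offset[where i = 1]) (simp_all add: summableI del: listM.simps fact_Suc)
qed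

text \<open>The value of the multi-Bernoulli density at the set of entries of a list with distinct entries.\<close>
primrec mb_list :: "nat \<Rightarrow> (nat \<Rightarrow> real) \<Rightarrow> (nat \<Rightarrow> 'b \<Rightarrow> real) \<Rightarrow> 'b list \<Rightarrow> ennreal" where
  "mb_list 0 r f xs = (if xs = [] then 1 else 0)"
| "mb_list (Suc n) r f xs = ennreal (1 - r (Suc n)) * mb_list n r f xs
     + pick_sum xs (\<lambda>y ys. ennreal (r (Suc n)) * ennreal (f (Suc n) y) * mb_list n r f ys)"

lemma list_meas_mb_list:
  assumes "\<And>i. i \<in> {1..n} \<Longrightarrow> f i \<in> borel_measurable M"
  shows "list_meas M (mb_list n r f)"
  using assms
proof (induction n)
  case 0
  have "mb_list 0 r f \<in> borel_measurable (listM M n)" for n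
  proof (cases n)
    case 0
    then show ?thesis by simp
  next
    case (Suc m)
    have "(\<lambda>_. 0::ennreal) \<in> borel_measurable (listM M n)" by simp
    then show ?thesis
      by (rule measurable_cong[THEN iffD1, rotated])
        (use Suc in \<open>auto simp: space_listM\<close>)
  qed
  then show ?case unfolding list_meas_def by blast
next
  case (Suc n)
  have ih: "mb_list n r f \<in> borel_measurable (listM M k)" for k
    by (rule list_measD, rule Suc.IH) (use Suc.prems in auto)
  have fm: "f (Suc n) \<in> borel_measurable M" using Suc.prems by auto
  have "list_meas M (\<lambda>xs. pick_sum xs (\<lambda>y ys. ennreal (r (Suc n)) * ennreal (f (Suc n) y) * mb_list n r f ys))"
    by (rule list_meas_pick_sum) (use measurable_compose[OF measurable_fst fm] measurable_compose[OF measurable_snd ih] in measurable)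
  then have "list_meas M (\<lambda>xs. ennreal (1 - r (Suc n)) * mb_list n r f xs
     + pick_sum xs (\<lambda>y ys. ennreal (r (Suc n)) * ennreal (f (Suc n) y) * mb_list n r f ys))"
    using ih unfolding list_meas_def by (auto intro!: borel_measurable_add borel_measurable_times_ennreal)
  then show ?case unfolding mb_list.simps(2)[abs_def] .
qed

text \<open>\<open>G\<close> is generalised in the induction: removing the last component replaces
  \<open>G\<close> by its image under the operator of that component, which thereby becomes the
  innermost one of the \<open>foldr\<close>.\<close>

lemma lsetint_mb_list:
  assumes M: "sigma_finite_measure M"
    and f: "\<And>i. i \<in> {1..n} \<Longrightarrow> f i \<in> borel_measurable M"
    and G: "list_meas M G" "perm_inv (space M) G"
  shows "lsetint M (\<lambda>xs. G xs * mb_list n r f xs)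
    = foldr (\<lambda>i. bernoulli_op (ennreal (1 - r i)) (ennreal (r i)) M (\<lambda>x. ennreal (f i x)) (\<lambda>x. x)) [1..<Suc n] G []"
  using f G
proof (induction n arbitrary: G)
  case 0
  have "(\<integral>\<^sup>+xs. G xs * mb_list 0 r f xs \<partial>listM M n) = (if n = 0 then G [] else 0)" for n
  proof (cases n)
    case (Suc m)
    have "(\<integral>\<^sup>+xs. G xs * mb_list 0 r f xs \<partial>listM M n) = (\<integral>\<^sup>+xs. 0 \<partial>listM M n)"
      by (rule nn_integral_cong) (use Suc in \<open>auto simp: space_listM\<close>)
    with Suc show ?thesis by simp
  qed (simp add: nn_integral_count_space_finite)
  then have "lsetint M (\<lambda>xs. G xs * mb_list 0 r f xs) = (\<Sum>n. if n = 0 then G [] else 0)"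
    unfolding lsetint_def
    by (intro arg_cong[where f = suminf] ext) (auto simp: divide_ennreal_def)
  also have "\<dots> = G []"
    using suminf_finite[of "{0::nat}" "\<lambda>n. if n = 0 then G [] else 0"] by simp
  finally show ?case by simp
next
  case (Suc n)
  interpret M: sigma_finite_measure M by fact
  let ?T = "\<lambda>i. bernoulli_op (ennreal (1 - r i)) (ennreal (r i)) M (\<lambda>x. ennreal (f i x)) (\<lambda>x. x)"
  have fm [measurable]: "f (Suc n) \<in> borel_measurable M" using Suc.prems by auto
  have mm [measurable]: "mb_list n r f \<in> borel_measurable (listM M k)" for k
    by (rule list_measD, rule list_meas_mb_list) (use Suc.prems in auto)
  note Gm [measurable] = list_measD[OF Suc.prems(2)]
  let ?h = "\<lambda>y ys. G (y # ys) * (ennreal (r (Suc n)) * ennreal (f (Suc n) y) * mb_list n r f ys)"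
  have GC [measurable]: "(\<lambda>q. G (fst q # snd q)) \<in> borel_measurable (M \<Otimes>\<^sub>M listM M k)" for k
    by (rule list_meas_Cons[OF Suc.prems(2) measurable_fst measurable_snd])
  have hm: "(\<lambda>q. ?h (fst q) (snd q)) \<in> borel_measurable (M \<Otimes>\<^sub>M listM M k)" for k
    by measurable
  have h_int: "(\<integral>\<^sup>+x. ?h x ys \<partial>M)
      = ennreal (r (Suc n)) * (\<integral>\<^sup>+x. ennreal (f (Suc n) x) * G (x # ys) \<partial>M) * mb_list n r f ys"
    if "set ys \<subseteq> space M" for ys
  proof -
    have [measurable]: "(\<lambda>x. G (x # ys)) \<in> borel_measurable M"
      using list_meas_Cons_const[OF Suc.prems(2) measurable_ident_sets[OF refl] that] .
    have "(\<integral>\<^sup>+x. ?h x ys \<partial>M)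
        = (\<integral>\<^sup>+x. ennreal (r (Suc n)) * mb_list n r f ys * (ennreal (f (Suc n) x) * G (x # ys)) \<partial>M)"
      by (simp add: ac_simps)
    also have "\<dots> = ennreal (r (Suc n)) * mb_list n r f ys * (\<integral>\<^sup>+x. ennreal (f (Suc n) x) * G (x # ys) \<partial>M)"
      by (rule nn_integral_cmult) measurable
    finally show ?thesis by (simp add: ac_simps)
  qed
  have T: "list_meas M (?T (Suc n) G)" "perm_inv (space M) (?T (Suc n) G)"
    using Suc.prems M by (auto intro!: bernoulli_op_list_meas bernoulli_op_perm_inv measurable_ident_sets)
  have lm: "list_meas M (\<lambda>xs. ennreal (1 - r (Suc n)) * (G xs * mb_list n r f xs))"
    unfolding list_meas_def by measurable
  have lI: "list_meas M (\<lambda>ys. \<integral>\<^sup>+x. ?h x ys \<partial>M)"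
    unfolding list_meas_def
  proof
    fix k
    have "(\<lambda>q. ?h (snd q) (fst q)) \<in> borel_measurable (listM M k \<Otimes>\<^sub>M M)"
    proof -
      have "(\<lambda>q. (snd q, fst q)) \<in> measurable (listM M k \<Otimes>\<^sub>M M) (M \<Otimes>\<^sub>M listM M k)"
        by (intro measurable_Pair measurable_fst measurable_snd)
      from measurable_compose[OF this hm] show ?thesis by simp
    qed
    then show "(\<lambda>ys. \<integral>\<^sup>+x. ?h x ys \<partial>M) \<in> borel_measurable (listM M k)"
      by (intro M.borel_measurable_nn_integral) (simp add: case_prod_beta')
  qed
  \<comment> \<open>Symmetry of \<open>G\<close> allows it to enter the sum over splits as
    \<open>G (y # ys)\<close>, with the picked entry in front.\<close>
  have "lsetint M (\<lambda>xs. G xs * mb_list (Suc n) r f xs)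
      = lsetint M (\<lambda>xs. ennreal (1 - r (Suc n)) * (G xs * mb_list n r f xs) + pick_sum xs ?h)"
    by (rule lsetint_cong)
      (simp only: mb_list.simps distrib_left pick_sum_mult_perm_inv[OF Suc.prems(3)] mult.left_commute[of "G _" "ennreal _"])
  also have "\<dots> = lsetint M (\<lambda>xs. ennreal (1 - r (Suc n)) * (G xs * mb_list n r f xs)) + lsetint M (\<lambda>xs. pick_sum xs ?h)"
    by (rule lsetint_add[OF lm list_meas_pick_sum[OF hm]])
  \<comment> \<open>The picked entry leaves the list and becomes the integration variable of the
    operator.\<close>
  also have "\<dots> = lsetint M (\<lambda>xs. ennreal (1 - r (Suc n)) * (G xs * mb_list n r f xs) + (\<integral>\<^sup>+x. ?h x xs \<partial>M))"
    unfolding lsetint_pick_sum[OF M hm] by (rule lsetint_add[OF lm lI, symmetric])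
  also have "\<dots> = lsetint M (\<lambda>xs. ?T (Suc n) G xs * mb_list n r f xs)"
    by (rule lsetint_cong) (simp only: h_int, simp only: bernoulli_op_def distrib_right mult.assoc)
  also have "\<dots> = foldr ?T [1..<Suc n] (?T (Suc n) G) []"
    by (rule Suc.IH[OF _ T]) (use Suc.prems in auto)
  also have "\<dots> = foldr ?T [1..<Suc (Suc n)] G []" by simp
  finally show ?case .
qed

section \<open>Multi-Bernoulli densities of sets of trajectories\<close>

definition mb_set :: "nat \<Rightarrow> (nat \<Rightarrow> real) \<Rightarrow> (nat \<Rightarrow> 'a traj \<Rightarrow> real) \<Rightarrow> 'a traj set \<Rightarrow> real" where
  "mb_set n r f S = (\<Sum>Xs\<in>decomps n S. \<Prod>i\<in>{1..n}. bern (r i) (f i) (Xs i))"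

lemma finite_decomps: "finite S \<Longrightarrow> finite (decomps n S)"
  unfolding decomps_def by (rule finite_subset[of _ "PiE {1..n} (\<lambda>_. Pow S)"]) (auto intro: finite_PiE)

lemma bern_nonneg: "0 \<le> r \<Longrightarrow> r \<le> 1 \<Longrightarrow> (\<And>X. 0 \<le> f X) \<Longrightarrow> 0 \<le> bern r f S"
  by (simp add: bern_def)

lemma mb_set_nonneg:
  assumes "\<And>i. i \<in> {1..n} \<Longrightarrow> 0 \<le> r i \<and> r i \<le> 1" "\<And>i X. i \<in> {1..n} \<Longrightarrow> 0 \<le> f i X"
  shows "0 \<le> mb_set n r f S"
  unfolding mb_set_def using assms by (intro sum_nonneg prod_nonneg bern_nonneg) auto

lemma mb_set_0: "mb_set 0 r f S = (if S = {} then 1 else 0)"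
proof -
  have "decomps 0 S = (if S = {} then {\<lambda>_. undefined} else {})"
    by (auto simp: decomps_def)
  then show ?thesis by (simp add: mb_set_def)
qed

text \<open>Decompositions are grouped by the part \<open>A\<close> assigned to the last component;
  what is left is a decomposition of \<open>S - A\<close> among the others.\<close>

lemma mb_set_Suc_Pow:
  fixes S :: "'a traj set"
  assumes "finite S"
  shows "mb_set (Suc n) r f S = (\<Sum>A\<in>Pow S. bern (r (Suc n)) (f (Suc n)) A * mb_set n r f (S - A))"
proof -
  let ?D = "Sigma (Pow S) (\<lambda>A. decomps n (S - A))"
  let ?b = "\<lambda>i. bern (r i) (f i)"
  have I: "{1..Suc n} = insert (Suc n) {1..n}" by (simp add: atLeastAtMostSuc_conv)
  have "mb_set (Suc n) r f S = (\<Sum>p\<in>?D. ?b (Suc n) (fst p) * (\<Prod>i\<in>{1..n}. ?b i (snd p i)))"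
    unfolding mb_set_def
  \<comment> \<open>The restriction to \<open>{1..n}\<close> is needed to stay among extensional
    functions: the value at \<open>Suc n\<close> must be reset to \<open>undefined\<close>.\<close>
  proof (rule sum.reindex_bij_witness[where i = "\<lambda>p. (snd p)(Suc n := fst p)"
        and j = "\<lambda>Xs. (Xs (Suc n), restrict Xs {1..n})"])
    fix Xs :: "nat \<Rightarrow> 'a traj set" assume Xs: "Xs \<in> decomps (Suc n) S"
    then have P: "Xs \<in> PiE (insert (Suc n) {1..n}) (\<lambda>_. Pow S)"
      and U0: "(\<Union>i\<in>insert (Suc n) {1..n}. Xs i) = S"
      and D: "\<And>i j. i \<in> insert (Suc n) {1..n} \<Longrightarrow> j \<in> insert (Suc n) {1..n} \<Longrightarrow> i \<noteq> j \<Longrightarrow> Xs i \<inter> Xs j = {}"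
      unfolding decomps_def I mem_Collect_eq by blast+
    from U0 have U: "Xs (Suc n) \<union> (\<Union>i\<in>{1..n}. Xs i) = S" by simp
    show "(snd (Xs (Suc n), restrict Xs {1..n}))(Suc n := fst (Xs (Suc n), restrict Xs {1..n})) = Xs"
    proof
      fix i
      show "((snd (Xs (Suc n), restrict Xs {1..n}))(Suc n := fst (Xs (Suc n), restrict Xs {1..n}))) i = Xs i"
        using PiE_arb[OF P, of i] by (auto simp: restrict_def)
    qed
    have D': "Xs i \<inter> Xs (Suc n) = {}" if "i \<in> {1..n}" for i
      using D[of i "Suc n"] that by auto
    have sub: "Xs i \<subseteq> S - Xs (Suc n)" if "i \<in> {1..n}" for i
    proof -
      from that have "Xs i \<subseteq> (\<Union>i\<in>{1..n}. Xs i)" by (rule UN_upper)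
      with U D'[OF that] show ?thesis by blast
    qed
    have "restrict Xs {1..n} \<in> decomps n (S - Xs (Suc n))"
      unfolding decomps_def mem_Collect_eq
    proof (intro conjI ballI impI)
      show "restrict Xs {1..n} \<in> PiE {1..n} (\<lambda>_. Pow (S - Xs (Suc n)))"
        using sub by (simp add: restrict_PiE_iff)
      show "(\<Union>i\<in>{1..n}. restrict Xs {1..n} i) = S - Xs (Suc n)"
      proof -
        have "(\<Union>i\<in>{1..n}. restrict Xs {1..n} i) = (\<Union>i\<in>{1..n}. Xs i)" by simp
        moreover have "(\<Union>i\<in>{1..n}. Xs i) \<inter> Xs (Suc n) = {}" using D' by blast
        moreover have "B = S' - A" if "B \<inter> A = {}" "A \<union> B = S'" for A B S' :: "'a traj set"
          using that by blast
        ultimately show ?thesis using U by metis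
      qed
      show "restrict Xs {1..n} i \<inter> restrict Xs {1..n} j = {}"
        if "i \<in> {1..n}" "j \<in> {1..n}" "i \<noteq> j" for i j
        using D[of i j] that by simp
    qed
    with U show "(Xs (Suc n), restrict Xs {1..n}) \<in> ?D" by auto
    show "?b (Suc n) (fst (Xs (Suc n), restrict Xs {1..n}))
          * (\<Prod>i\<in>{1..n}. ?b i (snd (Xs (Suc n), restrict Xs {1..n}) i))
        = (\<Prod>i\<in>{1..Suc n}. ?b i (Xs i))"
      by (simp add: I)
  next
    fix p :: "'a traj set \<times> (nat \<Rightarrow> 'a traj set)" assume "p \<in> ?D"
    then obtain A Xs where p: "p = (A, Xs)" "A \<subseteq> S" "Xs \<in> decomps n (S - A)" by auto
    then have P: "Xs \<in> PiE {1..n} (\<lambda>_. Pow (S - A))" and U: "(\<Union>i\<in>{1..n}. Xs i) = S - A"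
      and D: "\<And>i j. i \<in> {1..n} \<Longrightarrow> j \<in> {1..n} \<Longrightarrow> i \<noteq> j \<Longrightarrow> Xs i \<inter> Xs j = {}"
      unfolding decomps_def mem_Collect_eq by blast+
    have "restrict (Xs(Suc n := A)) {1..n} = Xs"
    proof
      fix i
      show "restrict (Xs(Suc n := A)) {1..n} i = Xs i" using PiE_arb[OF P, of i] by auto
    qed
    then show "(((snd p)(Suc n := fst p)) (Suc n), restrict ((snd p)(Suc n := fst p)) {1..n}) = p"
      by (simp add: p)
    have sub: "Xs i \<subseteq> S - A" if "i \<in> {1..n}" for i using P that by auto
    show "(snd p)(Suc n := fst p) \<in> decomps (Suc n) S"
      unfolding decomps_def I p(1) fst_conv snd_conv mem_Collect_eq
    proof (intro conjI ballI impI)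
      have "(Xs(Suc n := A)) i \<in> Pow S" if "i \<in> insert (Suc n) {1..n}" for i
        using sub[of i] p(2) that by (cases "i = Suc n") auto
      moreover have "(Xs(Suc n := A)) i = undefined" if "i \<notin> insert (Suc n) {1..n}" for i
        using PiE_arb[OF P, of i] that by simp
      ultimately show "Xs(Suc n := A) \<in> PiE (insert (Suc n) {1..n}) (\<lambda>_. Pow S)"
        by (rule PiE_I)
      have "(\<Union>i\<in>insert (Suc n) {1..n}. (Xs(Suc n := A)) i) = A \<union> (\<Union>i\<in>{1..n}. (Xs(Suc n := A)) i)"
        by (simp only: UN_insert fun_upd_same)
      also have "(\<Union>i\<in>{1..n}. (Xs(Suc n := A)) i) = (\<Union>i\<in>{1..n}. Xs i)"
        by (intro SUP_cong refl) simp
      finally have "(\<Union>i\<in>insert (Suc n) {1..n}. (Xs(Suc n := A)) i) = A \<union> (\<Union>i\<in>{1..n}. Xs i)" .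
      with U p(2) show "(\<Union>i\<in>insert (Suc n) {1..n}. (Xs(Suc n := A)) i) = S" by (metis Diff_partition)
      fix i j assume ij: "i \<in> insert (Suc n) {1..n}" "j \<in> insert (Suc n) {1..n}" "i \<noteq> j"
      then show "(Xs(Suc n := A)) i \<inter> (Xs(Suc n := A)) j = {}"
        using sub[of i] sub[of j] D[of i j] by (cases "i = Suc n"; cases "j = Suc n") auto
    qed
  qed
  also have "\<dots> = (\<Sum>A\<in>Pow S. \<Sum>Xs\<in>decomps n (S - A). ?b (Suc n) A * (\<Prod>i\<in>{1..n}. ?b i (Xs i)))"
    using assms by (subst sum.Sigma) (auto intro: finite_decomps simp: case_prod_beta')
  also have "\<dots> = (\<Sum>A\<in>Pow S. ?b (Suc n) A * mb_set n r f (S - A))"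
    by (simp add: mb_set_def sum_distrib_left)
  finally show ?thesis .
qed

text \<open>A Bernoulli density vanishes on sets with at least two elements, so among the subsets
  \<open>A\<close> only the empty set and the singletons contribute. The result mirrors the
  recursion of \<open>mb_list\<close>.\<close>

lemma mb_set_Suc:
  assumes "finite S"
  shows "mb_set (Suc n) r f S
    = (1 - r (Suc n)) * mb_set n r f S + (\<Sum>x\<in>S. r (Suc n) * f (Suc n) x * mb_set n r f (S - {x}))"
proof -
  let ?b = "bern (r (Suc n)) (f (Suc n))"
  have "mb_set (Suc n) r f S = (\<Sum>A\<in>Pow S. ?b A * mb_set n r f (S - A))"
    by (rule mb_set_Suc_Pow[OF assms])
  also have "\<dots> = (\<Sum>A\<in>insert {} ((\<lambda>x. {x}) ` S). ?b A * mb_set n r f (S - A))"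
    using assms by (intro sum.mono_neutral_right) (auto simp: bern_def)
  also have "\<dots> = ?b {} * mb_set n r f S + (\<Sum>A\<in>(\<lambda>x. {x}) ` S. ?b A * mb_set n r f (S - A))"
    using assms by (subst sum.insert) auto
  also have "(\<Sum>A\<in>(\<lambda>x. {x}) ` S. ?b A * mb_set n r f (S - A)) = (\<Sum>x\<in>S. ?b {x} * mb_set n r f (S - {x}))"
    by (subst sum.reindex) auto
  also have "?b {} = 1 - r (Suc n)" by (simp add: bern_def)
  also have "(\<Sum>x\<in>S. ?b {x} * mb_set n r f (S - {x})) = (\<Sum>x\<in>S. r (Suc n) * f (Suc n) x * mb_set n r f (S - {x}))"
    unfolding bern_def the_elem_eq by (intro sum.cong refl) auto
  finally show ?thesis .
qed

text \<open>Distinctness makes the two recursions agree: the list left after picking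
  \<open>x\<close> must represent \<open>set xs - {x}\<close>, which fails if a second copy of
  \<open>x\<close> stays behind.\<close>

lemma mb_list_eq_mb_set:
  assumes "\<And>i. i \<in> {1..n} \<Longrightarrow> 0 \<le> r i \<and> r i \<le> 1" "\<And>i X. i \<in> {1..n} \<Longrightarrow> 0 \<le> f i X"
    and "distinct xs"
  shows "mb_list n r f xs = ennreal (mb_set n r f (set xs))"
  using assms
proof (induction n arbitrary: xs)
  case 0
  show ?case by (simp add: mb_set_0)
next
  case (Suc n)
  have r: "0 \<le> r (Suc n)" "r (Suc n) \<le> 1" and f: "\<And>X. 0 \<le> f (Suc n) X" using Suc.prems by auto
  have nn: "0 \<le> mb_set n r f S" for S by (rule mb_set_nonneg) (use Suc.prems in auto)
  have ih: "mb_list n r f ys = ennreal (mb_set n r f (set ys))" if "distinct ys" for ys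
    using Suc.IH[OF _ _ that] Suc.prems by auto
  let ?g = "\<lambda>y S. ennreal (r (Suc n) * f (Suc n) y * mb_set n r f S)"
  have "pick_sum xs (\<lambda>y ys. ennreal (r (Suc n)) * ennreal (f (Suc n) y) * mb_list n r f ys)
      = pick_sum xs (\<lambda>y ys. ?g y (set ys))"
  proof (rule pick_sum_cong)
    fix y ys assume "mset (y # ys) = mset xs"
    with \<open>distinct xs\<close> have "distinct ys" by (metis distinct.simps(2) mset_eq_imp_distinct_iff)
    with r f nn show "ennreal (r (Suc n)) * ennreal (f (Suc n) y) * mb_list n r f ys = ?g y (set ys)"
      by (simp add: ih ennreal_mult)
  qed
  also have "\<dots> = (\<Sum>x\<in>set xs. ?g x (set xs - {x}))"
    by (rule pick_sum_distinct[OF \<open>distinct xs\<close>])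
  also have "\<dots> = ennreal (\<Sum>x\<in>set xs. r (Suc n) * f (Suc n) x * mb_set n r f (set xs - {x}))"
    using r f nn by (intro sum_ennreal) auto
  finally show ?case
    using r f nn
    by (simp add: mb_set_Suc ih \<open>distinct xs\<close> ennreal_mult ennreal_plus sum_nonneg del: ennreal_plus[symmetric])
qed

section \<open>Iterated integrals over trajectories and lists with repeated entries\<close>

lemma mint_eq_nn_integral:
  assumes "list_meas (trajS k) G"
  shows "mint k n G = (\<integral>\<^sup>+xs. G xs \<partial>listM (trajS k) n)"
  using assms
proof (induction n arbitrary: G)
  case 0
  show ?case by (simp add: nn_integral_count_space_finite)
next
  case (Suc n)
  interpret L: sigma_finite_measure "listM (trajS k :: 'a traj measure) n"
    by (rule sigma_finite_listM[OF sigma_finite_trajS])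
  have GX: "list_meas (trajS k) (\<lambda>xs. G (X # xs))" if "X \<in> traj_space k" for X
    unfolding list_meas_def
  proof
    fix m
    show "(\<lambda>xs. G (X # xs)) \<in> borel_measurable (listM (trajS k) m)"
      using that by (intro list_meas_Cons[OF Suc.prems, where n = m] measurable_const measurable_ident_sets refl)
        (simp add: space_trajS)
  qed
  have "mint k (Suc n) G = tint k (\<lambda>X. \<integral>\<^sup>+xs. G (X # xs) \<partial>listM (trajS k) n)"
    unfolding mint.simps by (intro tint_cong_space Suc.IH GX)
  also have "\<dots> = (\<integral>\<^sup>+X. (\<integral>\<^sup>+xs. G (X # xs) \<partial>listM (trajS k) n) \<partial>trajS k)"
  proof (rule nn_integral_trajS[symmetric], rule L.borel_measurable_nn_integral)
    show "(\<lambda>(X, xs). G (X # xs)) \<in> borel_measurable (trajS k \<Otimes>\<^sub>M listM (trajS k) n)"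
      using list_meas_Cons[OF Suc.prems measurable_fst measurable_snd] by (simp add: case_prod_beta')
  qed
  also have "\<dots> = (\<integral>\<^sup>+xs. G xs \<partial>listM (trajS k) (Suc n))"
    by (rule nn_integral_listM_Suc[symmetric, OF sigma_finite_trajS list_measD[OF Suc.prems]])
  finally show ?case .
qed

lemma setintL_eq_lsetint: "list_meas (trajS k) G \<Longrightarrow> setintL k G = lsetint (trajS k) G"
  by (simp add: setintL_def lsetint_def mint_eq_nn_integral)

text \<open>The condition \<open>b \<le> e\<close> makes the index set nonempty, so the measure of a
  point is a product with at least one factor and all factors zero. The product over an empty index
  set would have an atom.\<close>

lemma AE_trajM_notin_finite:
  assumes "b \<le> e" "finite N"
  shows "AE x in trajM b e. x \<notin> N"
proof -
  interpret product_sigma_finite "\<lambda>_::nat. lborel :: 'a measure" by (rule product_sigma_finite_lborel)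
  have sing: "{x} \<in> null_sets (trajM b e)" if x: "x \<in> space (trajM b e)" for x :: "nat \<Rightarrow> 'a"
  proof -
    have eq: "{x} = PiE {b..e} (\<lambda>i. {x i})"
      using x by (simp add: trajM_def space_PiM PiE_iff PiE_singleton)
    have "emeasure (trajM b e) {x} = (\<Prod>i\<in>{b..e}. emeasure lborel {x i})"
      unfolding eq trajM_def by (rule emeasure_PiM) auto
    also have "\<dots> = 0" using assms(1) by auto
    finally have "emeasure (trajM b e) {x} = 0" .
    moreover have "{x} \<in> sets (trajM b e)"
      unfolding eq trajM_def by (rule sets_PiM_I_finite) auto
    ultimately show ?thesis by (rule null_setsI)
  qed
  have "(\<Union>x\<in>N \<inter> space (trajM b e). {x}) \<in> null_sets (trajM b e)"
    using assms(2) sing by (intro null_sets.finite_UN) auto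
  then have "AE x in trajM b e. x \<notin> (\<Union>x\<in>N \<inter> space (trajM b e). {x})"
    by (rule AE_not_in)
  with AE_space show ?thesis by eventually_elim auto
qed

text \<open>Lists with a repeated entry form a null set. The exceptional set \<open>F\<close> carries the
  entries already integrated over, so no measurability of \<open>G\<close> is needed.\<close>
lemma mint_cong_distinct:
  assumes "finite F" "\<And>xs. distinct xs \<Longrightarrow> set xs \<subseteq> traj_space k - F \<Longrightarrow> G xs = G' xs"
  shows "mint k n G = mint k n G'"
  using assms
proof (induction n arbitrary: F G G')
  case 0
  show ?case using "0.prems"(2)[of "[]"] by simp
next
  case (Suc n)
  have step: "mint k n (\<lambda>xs. G (X # xs)) = mint k n (\<lambda>xs. G' (X # xs))"
    if "X \<in> traj_space k" "X \<notin> F" for X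
  proof (rule Suc.IH[of "insert X F"])
    show "finite (insert X F)" using Suc.prems(1) by simp
    show "G (X # xs) = G' (X # xs)" if "distinct xs" "set xs \<subseteq> traj_space k - insert X F" for xs
      by (rule Suc.prems(2)) (use that \<open>X \<in> traj_space k\<close> \<open>X \<notin> F\<close> in auto)
  qed
  show ?case
    unfolding mint.simps tint_def
  proof (intro sum.cong refl nn_integral_cong_AE)
    fix be assume be: "be \<in> BE k"
    have "AE x in trajM (fst be) (snd be). x \<notin> (\<lambda>X. snd (snd X)) ` F"
      using be Suc.prems(1) by (intro AE_trajM_notin_finite) (auto simp: BE_def)
    with AE_space show "AE x in trajM (fst be) (snd be).
        mint k n (\<lambda>xs. G ((fst be, snd be, x) # xs)) = mint k n (\<lambda>xs. G' ((fst be, snd be, x) # xs))"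
    proof eventually_elim
      case (elim x)
      with be have "(fst be, snd be, x) \<in> traj_space k" "(fst be, snd be, x) \<notin> F"
        by (force simp: traj_space_def)+
      then show ?case by (rule step)
    qed
  qed
qed

lemma setintL_cong_distinct:
  assumes "\<And>xs. distinct xs \<Longrightarrow> set xs \<subseteq> traj_space k \<Longrightarrow> G xs = G' xs"
  shows "setintL k G = setintL k G'"
  unfolding setintL_def using mint_cong_distinct[of "{}" k G G'] assms by simp

text \<open>The hypothesis gives measurability separately for each list of types. Lists of a given
  length carry only finitely many lists of types, and the map to the latter is measurable, so the
  pieces can be glued.\<close>

lemma set_fun_measurable_list_meas:
  fixes \<phi> :: "'a::euclidean_space traj set \<Rightarrow> ennreal"
  assumes "set_fun_measurable k \<phi>"
  shows "list_meas (trajS k) (\<lambda>xs. \<phi> (set xs))"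
  unfolding list_meas_def
proof
  fix n
  let ?I = "{bes. set bes \<subseteq> BE k \<and> length bes = n}"
  \<comment> \<open>For fixed \<open>bes\<close> this is defined and measurable on all lists, thanks
    to the default values of \<open>traj_proj\<close>; it equals \<open>\<phi> (set xs)\<close>
    where \<open>bes\<close> is the list of types of \<open>xs\<close>.\<close>
  let ?F = "\<lambda>bes xs. \<phi> (set (map (\<lambda>i. (fst (bes!i), snd (bes!i), traj_proj (bes!i) (xs!i))) [0..<n]))"
  have "(\<lambda>xs. ?F (map traj_type xs) xs) \<in> borel_measurable (listM (trajS k) n)"
  proof (rule measurable_compose_countable'[where I = ?I])
    fix bes assume bes: "bes \<in> ?I"
    have 1: "(\<lambda>y. \<phi> (set (map (\<lambda>i. (fst (bes!i), snd (bes!i), y i)) [0..<n])))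
        \<in> borel_measurable (PiM {..<n} (\<lambda>i. trajM (fst (bes!i)) (snd (bes!i))))"
      using assms bes unfolding set_fun_measurable_def by auto
    have 2: "(\<lambda>xs. \<lambda>i\<in>{..<n}. traj_proj (bes!i) (xs!i))
        \<in> measurable (listM (trajS k) n) (PiM {..<n} (\<lambda>i. trajM (fst (bes!i)) (snd (bes!i))))"
      by (intro measurable_restrict measurable_compose[OF measurable_nth_listM measurable_traj_proj]) simp
    have "map (\<lambda>i. (fst (bes!i), snd (bes!i), (\<lambda>i\<in>{..<n}. traj_proj (bes!i) (xs!i)) i)) [0..<n]
        = map (\<lambda>i. (fst (bes!i), snd (bes!i), traj_proj (bes!i) (xs!i))) [0..<n]" for xs
      by (rule map_cong) auto
    with measurable_compose[OF 2 1] show "?F bes \<in> borel_measurable (listM (trajS k) n)" by simp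
  next
    show "countable ?I" by (intro countable_finite finite_lists_length_eq) simp
    have "(\<lambda>xs :: 'a traj list. map traj_type xs) \<in> measurable (listM (trajS k) n) (count_space UNIV)"
    proof (induction n)
      case 0
      show ?case by simp
    next
      case (Suc n)
      have "(\<lambda>q :: 'a traj \<times> 'a traj list. (traj_type (fst q), map traj_type (snd q)))
          \<in> measurable (trajS k \<Otimes>\<^sub>M listM (trajS k) n) (count_space UNIV \<Otimes>\<^sub>M count_space UNIV)"
        by (intro measurable_Pair measurable_compose[OF measurable_fst measurable_traj_type]
            measurable_compose[OF measurable_snd Suc])
      then have *: "(\<lambda>q :: 'a traj \<times> 'a traj list. (traj_type (fst q), map traj_type (snd q)))
          \<in> measurable (trajS k \<Otimes>\<^sub>M listM (trajS k) n) (count_space UNIV)"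
        by (simp add: pair_measure_countable)
      have "(\<lambda>q. fst q # snd q) \<in> measurable (count_space UNIV) (count_space UNIV)" by simp
      from measurable_compose[OF * this] show ?case
        by (simp add: measurable_listM_Suc_iff case_prod_beta')
    qed
    note m = this
    show "map traj_type \<in> measurable (listM (trajS k :: 'a traj measure) n) (count_space ?I)"
    proof (rule measurableI)
      fix xs :: "'a traj list" assume "xs \<in> space (listM (trajS k) n)"
      then have "length xs = n" "set xs \<subseteq> space (trajS k)" by (auto simp: space_listM)
      moreover from this have "traj_type ` set xs \<subseteq> BE k" using traj_type_space by blast
      ultimately show "map traj_type xs \<in> space (count_space ?I)" by simp
    qed (use measurable_sets[OF m] in auto)
  qed
  moreover have "?F (map traj_type xs) xs = \<phi> (set xs)" if "xs \<in> space (listM (trajS k) n)" for xs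
  proof -
    have "map (\<lambda>i. (fst (map traj_type xs!i), snd (map traj_type xs!i), traj_proj (map traj_type xs!i) (xs!i))) [0..<n] = xs"
      using that by (intro nth_equalityI) (auto simp: space_listM traj_proj_eq)
    then show ?thesis by simp
  qed
  ultimately show "(\<lambda>xs. \<phi> (set xs)) \<in> borel_measurable (listM (trajS k) n)"
    by (simp cong: measurable_cong)
qed

section \<open>Survival and birth operators\<close>

definition survop :: "nat \<Rightarrow> ('a::euclidean_space \<Rightarrow> real) \<Rightarrow> ('a \<Rightarrow> 'a \<Rightarrow> real) \<Rightarrow> 'a traj
    \<Rightarrow> ('a traj list \<Rightarrow> ennreal) \<Rightarrow> 'a traj list \<Rightarrow> ennreal" where
  "survop k PS pix X = bernoulli_op (ennreal (1 - PSk k PS X)) (ennreal (PSk k PS X)) lborel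
     (\<lambda>y. ennreal (pix (snd (snd X) (fst (snd X))) y)) (ext_traj X)"

text \<open>Besides birth, this operator represents a prior component when taken at the prior time,
  and a predicted component when taken at the new time.\<close>

definition birthop :: "nat \<Rightarrow> real \<Rightarrow> ('a::euclidean_space traj \<Rightarrow> real)
    \<Rightarrow> ('a traj list \<Rightarrow> ennreal) \<Rightarrow> 'a traj list \<Rightarrow> ennreal" where
  "birthop k r f = bernoulli_op (ennreal (1 - r)) (ennreal r) (trajS k) (\<lambda>X. ennreal (f X)) (\<lambda>X. X)"

text \<open>Each survival step modifies the test function by inserting a trajectory. All test
  functions that arise have the form \<open>\<lambda>S. \<phi> (set zs \<union> S)\<close>, so the
  list \<open>zs\<close> of inserted trajectories can replace them as the variable; it is
  generalised in the induction.\<close>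

lemma survE_eq_foldr:
  "survE k PS pix B (\<lambda>S. \<phi> (set zs \<union> S)) xs
    = foldr (survop k PS pix) xs (\<lambda>zs. B (\<lambda>S. \<phi> (set zs \<union> S))) zs"
proof (induction xs arbitrary: zs)
  case (Cons X xs)
  have "(\<lambda>S. \<phi> (set zs \<union> insert Z S)) = (\<lambda>S. \<phi> (set (Z # zs) \<union> S))" for Z by simp
  then show ?case by (simp only: survE.simps foldr.simps o_apply survop_def bernoulli_op_def Cons.IH)
qed simp

lemma survop_apply:
  "survop k PS pix X G zs = ennreal (1 - PSk k PS X) * G zs
    + ennreal (PSk k PS X) * (\<integral>\<^sup>+y. ennreal (pix (snd (snd X) (fst (snd X))) y) * G (ext_traj X y # zs) \<partial>lborel)"
  by (simp add: survop_def bernoulli_op_def)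

lemma birthop_apply:
  "birthop k r f G zs = ennreal (1 - r) * G zs + ennreal r * (\<integral>\<^sup>+X. ennreal (f X) * G (X # zs) \<partial>trajS k)"
  by (simp add: birthop_def bernoulli_op_def)

lemma birthop_list_meas:
  "f \<in> borel_measurable (trajS k) \<Longrightarrow> list_meas (trajS k) G \<Longrightarrow> list_meas (trajS k) (birthop k r f G)"
  unfolding birthop_def by (intro bernoulli_op_list_meas sigma_finite_trajS measurable_ident_sets refl) auto

lemma birthop_perm_inv: "perm_inv (traj_space k) G \<Longrightarrow> perm_inv (traj_space k) (birthop k r f G)"
  unfolding birthop_def by (rule bernoulli_op_perm_inv) (auto simp: space_trajS)

lemma birthop_cong:
  assumes "set zs \<subseteq> traj_space k" "\<And>zs. set zs \<subseteq> traj_space k \<Longrightarrow> G zs = G' zs"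
  shows "birthop k r f G zs = birthop k r f G' zs"
  unfolding birthop_def by (rule bernoulli_op_cong) (use assms in \<open>auto simp: space_trajS\<close>)

lemma foldr_birthop_list_meas:
  assumes "\<And>l. l \<in> set ls \<Longrightarrow> f l \<in> borel_measurable (trajS k)" "list_meas (trajS k) G"
  shows "list_meas (trajS k) (foldr (\<lambda>l. birthop k (r l) (f l)) ls G)"
  using assms by (induction ls) (auto intro: birthop_list_meas)

lemma foldr_birthop_perm_inv:
  "perm_inv (traj_space k) G \<Longrightarrow> perm_inv (traj_space k) (foldr (\<lambda>l. birthop k (r l) (f l)) ls G)"
  by (induction ls) (auto intro: birthop_perm_inv)

text \<open>The same replacement of test functions by an accumulated list. Measurability enters
  because \<open>birthE\<close> integrates by \<open>tint\<close> and the operator against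
  \<open>trajS k\<close>.\<close>

lemma birthE_eq_foldr:
  assumes "\<And>l. l \<in> set ls \<Longrightarrow> f l \<in> borel_measurable (trajS k)"
    and "list_meas (trajS k) (\<lambda>zs. \<phi> (set zs))" "set zs \<subseteq> traj_space k"
  shows "birthE k r f ls (\<lambda>S. \<phi> (set zs \<union> S))
    = foldr (\<lambda>l. birthop k (r l) (f l)) ls (\<lambda>zs. \<phi> (set zs)) zs"
  using assms
proof (induction ls arbitrary: zs)
  case (Cons l ls)
  let ?G = "foldr (\<lambda>l. birthop k (r l) (f l)) ls (\<lambda>zs. \<phi> (set zs))"
  have G: "list_meas (trajS k) ?G" using Cons.prems by (intro foldr_birthop_list_meas) auto
  have m: "(\<lambda>X. ?G (X # zs)) \<in> borel_measurable (trajS k)"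
    by (rule list_meas_Cons_const[OF G measurable_ident_sets[OF refl]])
      (use Cons.prems in \<open>simp add: space_trajS\<close>)
  have eq: "(\<lambda>S. \<phi> (set zs \<union> insert Z S)) = (\<lambda>S. \<phi> (set (Z # zs) \<union> S))" for Z by simp
  have ih: "birthE k r f ls (\<lambda>S. \<phi> (set zs \<union> S)) = ?G zs" if "set zs \<subseteq> traj_space k" for zs
    using Cons that by simp
  have "tint k (\<lambda>X. ennreal (f l X) * birthE k r f ls (\<lambda>S. \<phi> (set zs \<union> insert X S)))
      = tint k (\<lambda>X. ennreal (f l X) * ?G (X # zs))"
    unfolding eq by (intro tint_cong_space arg_cong2[where f = times] refl ih) (use Cons.prems in auto)
  also have "\<dots> = (\<integral>\<^sup>+X. ennreal (f l X) * ?G (X # zs) \<partial>trajS k)"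
    by (rule nn_integral_trajS[symmetric])
      (use m Cons.prems(1)[of l] in \<open>auto intro!: borel_measurable_times_ennreal\<close>)
  finally show ?case
    using ih[OF Cons.prems(3)] by (simp only: birthE.simps foldr.simps o_apply birthop_apply[of k "r l" "f l" ?G zs])
qed simp

section \<open>Survival operators from time \<open>j\<close> to time \<open>Suc j\<close>\<close>

locale surv_model =
  fixes j :: nat and PS :: "'a::euclidean_space \<Rightarrow> real" and pix :: "'a \<Rightarrow> 'a \<Rightarrow> real"
  assumes PS_prob: "\<And>x. 0 \<le> PS x \<and> PS x \<le> 1"
    and PS_meas: "PS \<in> borel_measurable lborel"
    and pix_nonneg: "\<And>x y. 0 \<le> pix x y"
    and pix_meas: "(\<lambda>(x, y). pix x y) \<in> borel_measurable (lborel \<Otimes>\<^sub>M lborel)"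
begin

abbreviation "F \<equiv> survop (Suc j) PS pix"

abbreviation final :: "'a traj \<Rightarrow> 'a" where "final X \<equiv> snd (snd X) (fst (snd X))"

text \<open>On one component, extension adds the coordinate \<open>Suc e\<close> to a product space.
  Joint measurability in the trajectory and the new state is what the later uses of Fubini
  require.\<close>

lemma measurable_ext_traj2:
  "(\<lambda>q. ext_traj (fst q) (snd q)) \<in> measurable (trajS j \<Otimes>\<^sub>M (lborel :: 'a measure)) (trajS (Suc j))"
proof (rule measurable_trajS_pairI)
  fix b e assume be: "(b, e) \<in> BE j"
  then have I: "insert (Suc e) {b..e} = {b..Suc e}" and be': "(b, Suc e) \<in> BE (Suc j)"
    by (auto simp: BE_def)
  have "(\<lambda>(x, y). x(Suc e := y)) \<in> measurable (trajM b e \<Otimes>\<^sub>M (lborel :: 'a measure)) (trajM b (Suc e))"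
    using measurable_add_dim[of "Suc e" "{b..e}" "\<lambda>_. lborel :: 'a measure"]
    unfolding trajM_def I .
  from measurable_compose[OF this measurable_Pair_traj[OF be']]
  show "(\<lambda>(x, y). ext_traj (fst ((b, e, x), y)) (snd ((b, e, x), y)))
      \<in> measurable (trajM b e \<Otimes>\<^sub>M (lborel :: 'a measure)) (trajS (Suc j))"
    by (simp add: ext_traj_def case_prod_beta')
qed

lemma measurable_ext_traj:
  fixes X :: "'a traj"
  assumes "X \<in> traj_space j"
  shows "ext_traj X \<in> measurable lborel (trajS (Suc j))"
proof -
  have "X \<in> space (trajS j)" using assms by (simp add: space_trajS)
  from measurable_compose[OF measurable_Pair1'[OF this] measurable_ext_traj2] show ?thesis by simp
qed

lemma measurable_final: "(\<lambda>X. final X) \<in> measurable (trajS j) (lborel :: 'a measure)"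
  unfolding measurable_trajS_iff
proof
  fix be assume "be \<in> BE j"
  then have "snd be \<in> {fst be..snd be}" by (auto simp: BE_def)
  then show "(\<lambda>x. final (fst be, snd be, x)) \<in> measurable (trajM (fst be) (snd be)) (lborel :: 'a measure)"
    unfolding trajM_def by simp
qed

lemma measurable_pix_final:
  "(\<lambda>q. pix (final (fst q)) (snd q)) \<in> borel_measurable (trajS j \<Otimes>\<^sub>M lborel)"
proof -
  have "(\<lambda>q. (final (fst q), snd q)) \<in> measurable (trajS j \<Otimes>\<^sub>M lborel) (lborel \<Otimes>\<^sub>M (lborel :: 'a measure))"
    by (intro measurable_Pair measurable_compose[OF measurable_fst measurable_final] measurable_snd)
  from measurable_compose[OF this pix_meas] show ?thesis by simp
qed

lemma measurable_pix: "(\<lambda>y. ennreal (pix x y)) \<in> borel_measurable lborel"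
  using measurable_compose[OF measurable_Pair1'[of x lborel lborel] pix_meas] by simp

lemma measurable_PSk: "PSk (Suc j) PS \<in> borel_measurable (trajS j)"
  unfolding measurable_trajS_iff
proof
  fix be assume be: "be \<in> BE j"
  show "(\<lambda>x. PSk (Suc j) PS (fst be, snd be, x)) \<in> borel_measurable (trajM (fst be) (snd be))"
  proof (cases "snd be = j")
    case True
    from measurable_compose[OF measurable_final PS_meas]
    have "(\<lambda>x. PS (x (snd be))) \<in> borel_measurable (trajM (fst be) (snd be))"
      using be unfolding measurable_trajS_iff by auto
    with True show ?thesis by (simp add: PSk_def)
  qed (simp add: PSk_def)
qed

lemma PSk_bounds: "0 \<le> PSk (Suc j) PS X" "PSk (Suc j) PS X \<le> 1"
  using PS_prob by (auto simp: PSk_def split: prod.split)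

lemma survop_list_meas:
  "X \<in> traj_space j \<Longrightarrow> list_meas (trajS (Suc j)) G \<Longrightarrow> list_meas (trajS (Suc j)) (F X G)"
  unfolding survop_def
  by (intro bernoulli_op_list_meas measurable_ext_traj measurable_pix) (auto intro: lborel.sigma_finite_measure_axioms)

lemma survop_perm_inv:
  "X \<in> traj_space j \<Longrightarrow> perm_inv (traj_space (Suc j)) G \<Longrightarrow> perm_inv (traj_space (Suc j)) (F X G)"
  unfolding survop_def
  using measurable_space[OF measurable_ext_traj]
  by (intro bernoulli_op_perm_inv) (auto simp: space_trajS)

lemma survop_cong:
  assumes "X \<in> traj_space j" "set zs \<subseteq> traj_space (Suc j)"
    and "\<And>zs. set zs \<subseteq> traj_space (Suc j) \<Longrightarrow> G zs = G' zs"
  shows "F X G zs = F X G' zs"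
  unfolding survop_def
  using measurable_space[OF measurable_ext_traj[OF assms(1)]] assms
  by (intro bernoulli_op_cong) (auto simp: space_trajS)

lemma foldr_survop_list_meas:
  "set xs \<subseteq> traj_space j \<Longrightarrow> list_meas (trajS (Suc j)) G \<Longrightarrow> list_meas (trajS (Suc j)) (foldr F xs G)"
  by (induction xs) (auto intro: survop_list_meas)

lemma foldr_survop_perm_inv:
  "set xs \<subseteq> traj_space j \<Longrightarrow> perm_inv (traj_space (Suc j)) G \<Longrightarrow> perm_inv (traj_space (Suc j)) (foldr F xs G)"
  by (induction xs) (auto intro: survop_perm_inv)

lemma foldr_survop_cong:
  assumes "set xs \<subseteq> traj_space j" "set zs \<subseteq> traj_space (Suc j)"
    and "\<And>zs. set zs \<subseteq> traj_space (Suc j) \<Longrightarrow> G zs = G' zs"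
  shows "foldr F xs G zs = foldr F xs G' zs"
  using assms by (induction xs arbitrary: zs) (auto intro!: survop_cong)

lemma survop_commute:
  assumes "X \<in> traj_space j" "Y \<in> traj_space j"
    and "list_meas (trajS (Suc j)) G" "perm_inv (traj_space (Suc j)) G" "set zs \<subseteq> traj_space (Suc j)"
  shows "F X (F Y G) zs = F Y (F X G) zs"
  unfolding survop_def
  by (rule bernoulli_op_commute[OF lborel.sigma_finite_measure_axioms measurable_pix measurable_ext_traj[OF assms(1)]
        lborel.sigma_finite_measure_axioms measurable_pix measurable_ext_traj[OF assms(2)]])
    (use assms in \<open>simp_all add: space_trajS\<close>)

lemma survop_birthop_commute:
  assumes "X \<in> traj_space j" "f \<in> borel_measurable (trajS (Suc j))"
    and "list_meas (trajS (Suc j)) G" "perm_inv (traj_space (Suc j)) G" "set zs \<subseteq> traj_space (Suc j)"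
  shows "F X (birthop (Suc j) r f G) zs = birthop (Suc j) r f (F X G) zs"
  unfolding survop_def birthop_def
  by (rule bernoulli_op_commute[OF lborel.sigma_finite_measure_axioms measurable_pix measurable_ext_traj[OF assms(1)]
        sigma_finite_trajS _ measurable_ident_sets[OF refl]])
    (use assms in \<open>simp_all add: space_trajS\<close>)

lemma foldr_survop_birthop_commute:
  assumes "set xs \<subseteq> traj_space j" "f \<in> borel_measurable (trajS (Suc j))"
    and "list_meas (trajS (Suc j)) G" "perm_inv (traj_space (Suc j)) G" "set zs \<subseteq> traj_space (Suc j)"
  shows "foldr F xs (birthop (Suc j) r f G) zs = birthop (Suc j) r f (foldr F xs G) zs"
  using assms(1,5)
proof (induction xs arbitrary: zs)
  case (Cons X xs)
  have "F X (foldr F xs (birthop (Suc j) r f G)) zs = F X (birthop (Suc j) r f (foldr F xs G)) zs"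
    by (rule survop_cong) (use Cons in auto)
  also have "\<dots> = birthop (Suc j) r f (F X (foldr F xs G)) zs"
    using Cons.prems assms(2-4)
    by (intro survop_birthop_commute foldr_survop_list_meas foldr_survop_perm_inv) auto
  finally show ?case by simp
qed simp

text \<open>Commuting neighbouring survival operators brings a chosen trajectory to the front.
  Repeating this shows that the fold depends only on the multiset of prior trajectories, hence is
  symmetric in them.\<close>

lemma foldr_survop_remove1:
  assumes "list_meas (trajS (Suc j)) G" "perm_inv (traj_space (Suc j)) G"
    and "X \<in> set xs" "set xs \<subseteq> traj_space j" "set zs \<subseteq> traj_space (Suc j)"
  shows "foldr F xs G zs = F X (foldr F (remove1 X xs) G) zs"
  using assms(3-5)
proof (induction xs arbitrary: zs)
  case (Cons Y xs)
  show ?case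
  proof (cases "X = Y")
    case False
    have r: "set (remove1 X xs) \<subseteq> traj_space j" using set_remove1_subset[of X xs] Cons.prems by auto
    have "F Y (foldr F xs G) zs = F Y (F X (foldr F (remove1 X xs) G)) zs"
      by (rule survop_cong) (use Cons False in auto)
    also have "\<dots> = F X (F Y (foldr F (remove1 X xs) G)) zs"
      using Cons.prems assms(1,2) r
      by (intro survop_commute foldr_survop_list_meas foldr_survop_perm_inv) auto
    finally show ?thesis using False by simp
  qed simp
qed simp

lemma foldr_survop_mset:
  assumes "list_meas (trajS (Suc j)) G" "perm_inv (traj_space (Suc j)) G"
    and "mset xs = mset ys" "set xs \<subseteq> traj_space j" "set zs \<subseteq> traj_space (Suc j)"
  shows "foldr F xs G zs = foldr F ys G zs"
  using assms(3-5)
proof (induction xs arbitrary: ys zs)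
  case (Cons X xs)
  have X: "X \<in> set ys" "set ys \<subseteq> traj_space j"
    using Cons.prems(1,2) mset_eq_setD[OF Cons.prems(1)] by auto
  have m: "mset xs = mset (remove1 X ys)"
    using Cons.prems(1) by (simp flip: Cons.prems(1))
  have "F X (foldr F xs G) zs = F X (foldr F (remove1 X ys) G) zs"
    by (rule survop_cong) (use Cons m in auto)
  also have "\<dots> = foldr F ys G zs"
    by (rule foldr_survop_remove1[OF assms(1,2) X Cons.prems(3), symmetric])
  finally show ?case by simp
qed simp

text \<open>Joint measurability in both lists is required since every survival step takes a
  trajectory from the second list and may put its extension on the first. For the same reason the
  length \<open>m\<close> is arbitrary in the induction.\<close>

lemma measurable_foldr_survop:
  assumes "list_meas (trajS (Suc j)) G"
  shows "(\<lambda>q. foldr F (snd q) G (fst q))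
    \<in> borel_measurable (listM (trajS (Suc j)) m \<Otimes>\<^sub>M listM (trajS j) n)"
proof (induction n arbitrary: m)
  case 0
  have "(\<lambda>q. G (fst q)) \<in> borel_measurable (listM (trajS (Suc j)) m \<Otimes>\<^sub>M listM (trajS j) 0)"
    using measurable_compose[OF measurable_fst list_measD[OF assms]] .
  then show ?case
    by (rule measurable_cong[THEN iffD1, rotated]) (auto simp: space_pair_measure)
next
  case (Suc n)
  let ?L = "listM (trajS (Suc j)) m \<Otimes>\<^sub>M (trajS j \<Otimes>\<^sub>M listM (trajS j) n) :: ('a traj list \<times> 'a traj \<times> 'a traj list) measure"
  have P [measurable]: "(\<lambda>q. PSk (Suc j) PS (fst (snd q))) \<in> borel_measurable ?L"
    by (intro measurable_compose[OF _ measurable_PSk] measurable_compose[OF measurable_snd measurable_fst])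
  have "(\<lambda>q. (fst q, snd (snd q))) \<in> measurable ?L (listM (trajS (Suc j)) m \<Otimes>\<^sub>M listM (trajS j) n)"
    by (intro measurable_Pair measurable_fst measurable_compose[OF measurable_snd measurable_snd])
  from measurable_compose[OF this Suc[of m]]
  have 1 [measurable]: "(\<lambda>q. foldr F (snd (snd q)) G (fst q)) \<in> borel_measurable ?L" by simp
  have "(\<lambda>p. (fst (snd (fst p)), snd p)) \<in> measurable (?L \<Otimes>\<^sub>M lborel) (trajS j \<Otimes>\<^sub>M (lborel :: 'a measure))"
    by (intro measurable_Pair measurable_snd
        measurable_compose[OF measurable_fst measurable_compose[OF measurable_snd measurable_fst]])
  note X = this
  have 2: "(\<lambda>p. pix (final (fst (snd (fst p)))) (snd p)) \<in> borel_measurable (?L \<Otimes>\<^sub>M lborel)"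
    using measurable_compose[OF X measurable_pix_final] by simp
  have e: "(\<lambda>p. ext_traj (fst (snd (fst p))) (snd p)) \<in> measurable (?L \<Otimes>\<^sub>M lborel) (trajS (Suc j))"
    using measurable_compose[OF X measurable_ext_traj2] by simp
  have "(\<lambda>p. (ext_traj (fst (snd (fst p))) (snd p) # fst (fst p), snd (snd (fst p))))
      \<in> measurable (?L \<Otimes>\<^sub>M (lborel :: 'a measure)) (listM (trajS (Suc j)) (Suc m) \<Otimes>\<^sub>M listM (trajS j) n)"
    by (intro measurable_Pair measurable_Cons_listM e measurable_compose[OF measurable_fst measurable_fst]
        measurable_compose[OF measurable_fst measurable_compose[OF measurable_snd measurable_snd]])
  from measurable_compose[OF this Suc[of "Suc m"]]
  have 3: "(\<lambda>p. foldr F (snd (snd (fst p))) G (ext_traj (fst (snd (fst p))) (snd p) # fst (fst p)))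
      \<in> borel_measurable (?L \<Otimes>\<^sub>M (lborel :: 'a measure))" by simp
  have 4 [measurable]: "(\<lambda>q. \<integral>\<^sup>+y. ennreal (pix (final (fst (snd q))) y)
      * foldr F (snd (snd q)) G (ext_traj (fst (snd q)) y # fst q) \<partial>lborel) \<in> borel_measurable ?L"
    using 2 3 by (intro lborel.borel_measurable_nn_integral) (simp add: case_prod_beta')
  have "(\<lambda>q. F (fst (snd q)) (foldr F (snd (snd q)) G) (fst q)) \<in> borel_measurable ?L"
    unfolding survop_apply[of "Suc j" PS pix _ "foldr F (snd (snd _)) G"] by measurable
  then show ?case
    by (intro measurable_pair_listM_SucI) simp
qed

lemma foldr_survop_list_meas_list:
  assumes "list_meas (trajS (Suc j)) G" "set zs \<subseteq> traj_space (Suc j)"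
  shows "list_meas (trajS j) (\<lambda>xs. foldr F xs G zs)"
  unfolding list_meas_def
proof
  fix n
  have "zs \<in> space (listM (trajS (Suc j)) (length zs))"
    using assms(2) by (simp add: space_listM space_trajS)
  from measurable_compose[OF measurable_Pair1'[OF this] measurable_foldr_survop[OF assms(1)]]
  show "(\<lambda>xs. foldr F xs G zs) \<in> borel_measurable (listM (trajS j) n)" by simp
qed

lemma foldr_survop_perm_inv_list:
  assumes "list_meas (trajS (Suc j)) G" "perm_inv (traj_space (Suc j)) G" "set zs \<subseteq> traj_space (Suc j)"
  shows "perm_inv (traj_space j) (\<lambda>xs. foldr F xs G zs)"
  unfolding perm_inv_def using foldr_survop_mset[OF assms(1,2) _ _ assms(3)] by blast

end

section \<open>Survival turns prior components into predicted ones\<close>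

lemma traj_densityD:
  assumes "traj_density k f"
  shows "0 \<le> f X" "f \<in> borel_measurable (trajS k)" "(\<integral>\<^sup>+X. ennreal (f X) \<partial>trajS k) = 1"
proof -
  show "0 \<le> f X" using assms by (cases X) (simp add: traj_density_def)
  show m: "f \<in> borel_measurable (trajS k)"
    using assms by (simp add: traj_density_def measurable_trajS_iff)
  have "(\<integral>\<^sup>+X. ennreal (f X) \<partial>trajS k) = tint k (\<lambda>X. ennreal (f X))"
    by (rule nn_integral_trajS) (use m in measurable)
  with assms show "(\<integral>\<^sup>+X. ennreal (f X) \<partial>trajS k) = 1" by (simp add: traj_density_def)
qed

lemma inner_PS_nonneg: "0 \<le> inner_PS k PS f"
  by (simp add: inner_PS_def)

lemma measurable_birth_traj_density:
  assumes "g \<in> borel_measurable lborel"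
  shows "birth_traj_density k g \<in> borel_measurable (trajS k)"
  unfolding measurable_trajS_iff
proof
  fix be assume be: "be \<in> BE k"
  show "(\<lambda>x. birth_traj_density k g (fst be, snd be, x)) \<in> borel_measurable (trajM (fst be) (snd be))"
  proof (cases "fst be = k \<and> snd be = k")
    case True
    have "(\<lambda>x. x k) \<in> measurable (trajM k k) lborel"
      unfolding trajM_def by (rule measurable_component_singleton) simp
    from measurable_compose[OF this assms] True show ?thesis by (simp add: birth_traj_density_def)
  next
    case False
    then have "birth_traj_density k g (fst be, snd be, x) = 0" for x
      by (auto simp: birth_traj_density_def)
    then show ?thesis by simp
  qed
qed

section \<open>The predicted density and the change of variables\<close>

context surv_model
begin

lemma measurable_pred_num:
  assumes "f \<in> borel_measurable (trajS j)"
  shows "pred_num (Suc j) PS pix f \<in> borel_measurable (trajS (Suc j))"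
  unfolding measurable_trajS_iff
proof
  fix be assume be: "be \<in> BE (Suc j)"
  obtain b e where [simp]: "be = (b, e)" by (cases be)
  show "(\<lambda>x. pred_num (Suc j) PS pix f (fst be, snd be, x)) \<in> borel_measurable (trajM (fst be) (snd be))"
  proof (cases "e = Suc j \<and> b \<le> j")
    case True
    then have bj: "(b, j) \<in> BE j" by (simp add: BE_def)
    have res: "(\<lambda>x :: nat \<Rightarrow> 'a. (b, j, restrict x {b..j})) \<in> measurable (trajM b (Suc j)) (trajS j)"
    proof -
      have "(\<lambda>x. restrict x {b..j}) \<in> measurable (trajM b (Suc j)) (trajM b j :: (nat \<Rightarrow> 'a) measure)"
        unfolding trajM_def by (rule measurable_restrict_subset) auto
      from measurable_compose[OF this measurable_Pair_traj[OF bj]] show ?thesis .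
    qed
    have 1: "(\<lambda>x. PSk (Suc j) PS (b, j, restrict x {b..j})) \<in> borel_measurable (trajM b (Suc j))"
      by (rule measurable_compose[OF res measurable_PSk])
    have 2: "(\<lambda>x. f (b, j, restrict x {b..j})) \<in> borel_measurable (trajM b (Suc j))"
      by (rule measurable_compose[OF res assms])
    have "(\<lambda>x. (x j, x (Suc j))) \<in> measurable (trajM b (Suc j)) (lborel \<Otimes>\<^sub>M (lborel :: 'a measure))"
      unfolding trajM_def using True by (intro measurable_Pair measurable_component_singleton) auto
    from measurable_compose[OF this pix_meas]
    have 3: "(\<lambda>x. pix (x j) (x (Suc j))) \<in> borel_measurable (trajM b (Suc j))" by simp
    from 1 2 3 True show ?thesis
      by (simp add: pred_num_def borel_measurable_times)
  next
    case False
    then have "pred_num (Suc j) PS pix f (fst be, snd be, x) = 0" for x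
      by (auto simp: pred_num_def)
    then show ?thesis by simp
  qed
qed

lemma pred_num_nonneg: "(\<And>X. 0 \<le> f X) \<Longrightarrow> 0 \<le> pred_num (Suc j) PS pix f X"
  using pix_nonneg PSk_bounds(1) by (auto simp: pred_num_def split: prod.split)

lemma pred_density_nonneg: "(\<And>X. 0 \<le> f X) \<Longrightarrow> 0 \<le> pred_density (Suc j) PS pix f X"
  by (simp add: pred_density_def pred_num_nonneg inner_PS_nonneg)

lemma measurable_pred_density:
  "f \<in> borel_measurable (trajS j) \<Longrightarrow> pred_density (Suc j) PS pix f \<in> borel_measurable (trajS (Suc j))"
  unfolding pred_density_def[abs_def]
  by (intro borel_measurable_divide measurable_pred_num borel_measurable_const)

text \<open>The change of variables is \<open>Z = ext_traj X y\<close>. It matches the component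
  \<open>(b, j)\<close> together with a new state with the component \<open>(b, Suc j)\<close>,
  where the product measure splits off the coordinate \<open>Suc j\<close>. Components not matched
  in this way contribute zero on either side.\<close>

lemma nn_integral_extend:
  assumes f: "f \<in> borel_measurable (trajS j)" "\<And>X. 0 \<le> f X"
    and h: "h \<in> borel_measurable (trajS (Suc j))"
  shows "(\<integral>\<^sup>+X. ennreal (f X) * (ennreal (PSk (Suc j) PS X)
        * (\<integral>\<^sup>+y. ennreal (pix (final X) y) * h (ext_traj X y) \<partial>lborel)) \<partial>trajS j)
    = (\<integral>\<^sup>+Z. ennreal (pred_num (Suc j) PS pix f Z) * h Z \<partial>trajS (Suc j))"
proof -
  interpret product_sigma_finite "\<lambda>_::nat. lborel :: 'a measure" by (rule product_sigma_finite_lborel)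
  let ?l = "\<lambda>X. ennreal (f X) * (ennreal (PSk (Suc j) PS X)
        * (\<integral>\<^sup>+y. ennreal (pix (final X) y) * h (ext_traj X y) \<partial>lborel))"
  let ?r = "\<lambda>Z. ennreal (pred_num (Suc j) PS pix f Z) * h Z"
  let ?L = "\<lambda>be. \<integral>\<^sup>+x. ?l (fst be, snd be, x) \<partial>trajM (fst be) (snd be)"
  let ?R = "\<lambda>be. \<integral>\<^sup>+x. ?r (fst be, snd be, x) \<partial>trajM (fst be) (snd be)"
  have hm2: "(\<lambda>q. h (ext_traj (fst q) (snd q))) \<in> borel_measurable (trajS j \<Otimes>\<^sub>M lborel)"
    by (rule measurable_compose[OF measurable_ext_traj2 h])
  have "(\<lambda>X. \<integral>\<^sup>+y. ennreal (pix (final X) y) * h (ext_traj X y) \<partial>lborel) \<in> borel_measurable (trajS j)"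
    using hm2 measurable_pix_final
    by (intro lborel.borel_measurable_nn_integral) (simp add: case_prod_beta')
  then have lm: "?l \<in> borel_measurable (trajS j)"
    using f(1) measurable_PSk by measurable
  have rm: "?r \<in> borel_measurable (trajS (Suc j))"
    using h measurable_pred_num[OF f(1)] by measurable
  have main: "?L (b, j) = ?R (b, Suc j)" if b: "b \<le> j" for b
  proof -
    have I: "insert (Suc j) {b..j} = {b..Suc j}" using b by auto
    have bj: "(b, j) \<in> BE j" "(b, Suc j) \<in> BE (Suc j)" using b by (auto simp: BE_def)
    have rm': "(\<lambda>x. ?r (b, Suc j, x)) \<in> borel_measurable (trajM b (Suc j))"
      by (rule measurable_compose[OF measurable_Pair_traj[OF bj(2)] rm])
    have "?R (b, Suc j) = (\<integral>\<^sup>+x. (\<integral>\<^sup>+y. ?r (b, Suc j, x(Suc j := y)) \<partial>lborel) \<partial>trajM b j)"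
      using product_nn_integral_insert[of "{b..j}" "Suc j" "\<lambda>x. ?r (b, Suc j, x)"] rm'
      unfolding trajM_def I by simp
    also have "\<dots> = (\<integral>\<^sup>+x. ?l (b, j, x) \<partial>trajM b j)"
    proof (rule nn_integral_cong)
      fix x :: "nat \<Rightarrow> 'a" assume x: "x \<in> space (trajM b j)"
      then have res: "restrict (x(Suc j := y)) {b..j} = x" for y
        by (auto simp: trajM_def space_PiM PiE_def extensional_def restrict_def fun_eq_iff)
      have X: "(b, j, x) \<in> traj_space j" using x bj by (auto simp: traj_space_def)
      have pn: "pred_num (Suc j) PS pix f (b, Suc j, x(Suc j := y))
          = f (b, j, x) * PSk (Suc j) PS (b, j, x) * pix (x j) y" for y
        using b by (simp add: pred_num_def res)
      have "(\<lambda>y. h (ext_traj (b, j, x) y)) \<in> borel_measurable lborel"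
        by (rule measurable_compose[OF measurable_ext_traj[OF X] h])
      then have m: "(\<lambda>y. ennreal (pix (x j) y) * h (ext_traj (b, j, x) y)) \<in> borel_measurable lborel"
        using measurable_pix by (intro borel_measurable_times_ennreal)
      have "(\<integral>\<^sup>+y. ?r (b, Suc j, x(Suc j := y)) \<partial>lborel)
          = (\<integral>\<^sup>+y. ennreal (f (b, j, x)) * ennreal (PSk (Suc j) PS (b, j, x))
              * (ennreal (pix (x j) y) * h (ext_traj (b, j, x) y)) \<partial>lborel)"
        using f(2) PSk_bounds(1) pix_nonneg
        by (intro nn_integral_cong) (simp add: pn ennreal_mult ext_traj_def mult.assoc)
      also have "\<dots> = ?l (b, j, x)"
        by (subst nn_integral_cmult[OF m]) (simp add: mult.assoc)
      finally show "(\<integral>\<^sup>+y. ?r (b, Suc j, x(Suc j := y)) \<partial>lborel) = ?l (b, j, x)" .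
    qed
    finally show ?thesis by simp
  qed
  have subL: "(\<lambda>b. (b, j)) ` {..j} \<subseteq> BE j" and subR: "(\<lambda>b. (b, Suc j)) ` {..j} \<subseteq> BE (Suc j)"
    by (auto simp: BE_def)
  have L0: "?L be = 0" if "be \<in> BE j - (\<lambda>b. (b, j)) ` {..j}" for be
  proof -
    from that have "snd be \<noteq> j" by (cases be) (auto simp: BE_def)
    then have "PSk (Suc j) PS (fst be, snd be, x) = 0" for x by (simp add: PSk_def)
    then show ?thesis by simp
  qed
  \<comment> \<open>Left over are the trajectories that ended before \<open>Suc j\<close> and those
    born at \<open>Suc j\<close>; neither is the continuation of a prior trajectory.\<close>
  have R0: "?R be = 0" if "be \<in> BE (Suc j) - (\<lambda>b. (b, Suc j)) ` {..j}" for be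
  proof -
    from that have "\<not> (snd be = Suc j \<and> fst be \<le> j)" by (cases be) (auto simp: BE_def)
    then have "pred_num (Suc j) PS pix f (fst be, snd be, x) = 0" for x by (auto simp: pred_num_def)
    then show ?thesis by simp
  qed
  have "(\<integral>\<^sup>+X. ?l X \<partial>trajS j) = (\<Sum>be\<in>BE j. ?L be)"
    using nn_integral_trajS[OF lm] by (simp only: tint_def)
  also have "\<dots> = (\<Sum>be\<in>(\<lambda>b. (b, j)) ` {..j}. ?L be)"
    by (rule sum.mono_neutral_right[OF finite_BE subL ballI[OF L0]])
  also have "\<dots> = (\<Sum>b\<le>j. ?L (b, j))"
    by (subst sum.reindex) (auto simp: inj_on_def)
  also have "\<dots> = (\<Sum>b\<le>j. ?R (b, Suc j))"
    by (rule sum.cong) (use main in auto)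
  also have "\<dots> = (\<Sum>be\<in>(\<lambda>b. (b, Suc j)) ` {..j}. ?R be)"
    by (subst sum.reindex) (auto simp: inj_on_def)
  also have "\<dots> = (\<Sum>be\<in>BE (Suc j). ?R be)"
    by (rule sum.mono_neutral_left[OF finite_BE subR ballI[OF R0]])
  also have "\<dots> = (\<integral>\<^sup>+Z. ?r Z \<partial>trajS (Suc j))"
    using nn_integral_trajS[OF rm] by (simp only: tint_def)
  finally show ?thesis .
qed

text \<open>Surviving and disappearing mass add up to the total mass 1 of \<open>f\<close>. Both are
  therefore finite, so \<open>inner_PS\<close>, defined through \<open>enn2real\<close>, loses no
  information.\<close>

lemma survival_mass:
  assumes "traj_density j f"
  shows "(\<integral>\<^sup>+X. ennreal (f X) * ennreal (PSk (Suc j) PS X) \<partial>trajS j) = ennreal (inner_PS (Suc j) PS f)"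
    and "(\<integral>\<^sup>+X. ennreal (f X) * ennreal (1 - PSk (Suc j) PS X) \<partial>trajS j) = ennreal (1 - inner_PS (Suc j) PS f)"
    and "inner_PS (Suc j) PS f \<le> 1"
proof -
  note f = traj_densityD[OF assms]
  note [measurable] = f(2) measurable_PSk
  let ?s = "\<integral>\<^sup>+X. ennreal (f X) * ennreal (PSk (Suc j) PS X) \<partial>trajS j"
  let ?d = "\<integral>\<^sup>+X. ennreal (f X) * ennreal (1 - PSk (Suc j) PS X) \<partial>trajS j"
  have P1: "ennreal (PSk (Suc j) PS X) + ennreal (1 - PSk (Suc j) PS X) = 1" for X
    by (subst ennreal_plus[symmetric]) (use PSk_bounds in simp_all)
  have "?s + ?d = (\<integral>\<^sup>+X. ennreal (f X) * (ennreal (PSk (Suc j) PS X) + ennreal (1 - PSk (Suc j) PS X)) \<partial>trajS j)"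
    unfolding distrib_left by (rule nn_integral_add[symmetric]) measurable
  also have "\<dots> = 1" unfolding P1 using f(3) by simp
  finally have sum1: "?s + ?d = 1" .
  have "?s \<le> ?s + ?d" by (rule add_increasing2) auto
  then have s1: "?s \<le> 1" unfolding sum1 .
  then have fin: "?s < top" by (rule le_less_trans) simp
  have "?s = (\<integral>\<^sup>+X. ennreal (f X * PSk (Suc j) PS X) \<partial>trajS j)"
    by (intro nn_integral_cong ennreal_mult[symmetric] f(1) PSk_bounds(1))
  also have "\<dots> = tint j (\<lambda>X. ennreal (f X * PSk (Suc j) PS X))"
    by (rule nn_integral_trajS) measurable
  finally have "enn2real ?s = inner_PS (Suc j) PS f"
    unfolding inner_PS_def diff_Suc_1 by (rule arg_cong)
  with ennreal_enn2real[OF fin] show s: "?s = ennreal (inner_PS (Suc j) PS f)" by (simp only:)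
  from s1 show le: "inner_PS (Suc j) PS f \<le> 1" unfolding s by (simp only: ennreal_le_1)
  \<comment> \<open>Subtraction of extended reals cancels here because \<open>?s\<close> is
    finite.\<close>
  have "?d = (?s + ?d) - ?s" using fin by (intro ennreal_add_diff_cancel_left[symmetric]) auto
  also have "\<dots> = ennreal 1 - ennreal (inner_PS (Suc j) PS f)" unfolding sum1 unfolding s by simp
  also have "\<dots> = ennreal (1 - inner_PS (Suc j) PS f)" by (rule ennreal_minus[OF inner_PS_nonneg])
  finally show "?d = ennreal (1 - inner_PS (Suc j) PS f)" .
qed

text \<open>The left operator acts on the list of prior trajectories, the right one on the list of
  inserted trajectories. The exchange works because a prior trajectory put in front of
  \<open>xs\<close> is processed by the outermost survival operator, which in turn either leaves
  \<open>zs\<close> alone or puts an extension in front of it.\<close>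

lemma birthop_survop:
  assumes f: "traj_density j f" and r: "0 \<le> r" "r \<le> 1"
    and G: "list_meas (trajS (Suc j)) G" and xs: "set xs \<subseteq> traj_space j" and zs: "set zs \<subseteq> traj_space (Suc j)"
  shows "birthop j r f (\<lambda>xs. foldr F xs G zs) xs
    = birthop (Suc j) (r * inner_PS (Suc j) PS f) (pred_density (Suc j) PS pix f) (foldr F xs G) zs"
proof -
  note fd = traj_densityD[OF f]
  note [measurable] = fd(2) measurable_PSk
  let ?H = "foldr F xs G"
  let ?ip = "inner_PS (Suc j) PS f"
  have H: "list_meas (trajS (Suc j)) ?H" by (rule foldr_survop_list_meas[OF xs G])
  have Hm [measurable]: "(\<lambda>Z. ?H (Z # zs)) \<in> borel_measurable (trajS (Suc j))"
    by (rule list_meas_Cons_const[OF H measurable_ident_sets[OF refl]]) (use zs in \<open>simp add: space_trajS\<close>)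
  have ip: "0 \<le> ?ip" "?ip \<le> 1" using inner_PS_nonneg survival_mass(3)[OF f] by auto
  let ?I = "\<lambda>X. \<integral>\<^sup>+y. ennreal (pix (final X) y) * ?H (ext_traj X y # zs) \<partial>lborel"
  have "(\<lambda>q. ?H (ext_traj (fst q) (snd q) # zs)) \<in> borel_measurable (trajS j \<Otimes>\<^sub>M lborel)"
    by (rule measurable_compose[OF measurable_ext_traj2 Hm])
  then have Im [measurable]: "?I \<in> borel_measurable (trajS j)"
    using measurable_pix_final by (intro lborel.borel_measurable_nn_integral) (simp add: case_prod_beta')
  let ?N = "\<integral>\<^sup>+Z. ennreal (pred_num (Suc j) PS pix f Z) * ?H (Z # zs) \<partial>trajS (Suc j)"
  have ext: "(\<integral>\<^sup>+X. ennreal (f X) * (ennreal (PSk (Suc j) PS X) * ?I X) \<partial>trajS j) = ?N"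
    by (rule nn_integral_extend[OF fd(2,1) Hm])
  have "(\<integral>\<^sup>+X. ennreal (f X) * foldr F (X # xs) G zs \<partial>trajS j)
      = (\<integral>\<^sup>+X. (ennreal (f X) * ennreal (1 - PSk (Suc j) PS X)) * ?H zs
          + ennreal (f X) * (ennreal (PSk (Suc j) PS X) * ?I X) \<partial>trajS j)"
    by (intro nn_integral_cong) (simp only: foldr.simps o_apply survop_apply[of "Suc j" PS pix _ ?H] distrib_left mult.assoc)
  also have "\<dots> = ennreal (1 - ?ip) * ?H zs + ?N"
    by (simp add: nn_integral_add nn_integral_multc survival_mass(2)[OF f] ext)
  finally have A: "(\<integral>\<^sup>+X. ennreal (f X) * foldr F (X # xs) G zs \<partial>trajS j) = ennreal (1 - ?ip) * ?H zs + ?N" .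
  have B: "ennreal r * ?N = ennreal (r * ?ip)
      * (\<integral>\<^sup>+Z. ennreal (pred_density (Suc j) PS pix f Z) * ?H (Z # zs) \<partial>trajS (Suc j))"
  \<comment> \<open>If survival has probability zero, \<open>pred_density\<close> divides by zero
    and carries no information, but its existence probability is zero too. It remains to see that
    \<open>?N\<close> vanishes, and \<open>?N\<close> is an integral against the surviving mass,
    which is zero almost everywhere.\<close>
  proof (cases "?ip = 0")
    case True
    then have "(\<integral>\<^sup>+X. ennreal (f X) * ennreal (PSk (Suc j) PS X) \<partial>trajS j) = 0"
      using survival_mass(1)[OF f] by simp
    then have "AE X in trajS j. ennreal (f X) * ennreal (PSk (Suc j) PS X) = 0"
      by (subst (asm) nn_integral_0_iff_AE) measurable
    then have "AE X in trajS j. ennreal (f X) * (ennreal (PSk (Suc j) PS X) * ?I X) = 0"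
      by eventually_elim (simp flip: mult.assoc)
    then have "(\<integral>\<^sup>+X. ennreal (f X) * (ennreal (PSk (Suc j) PS X) * ?I X) \<partial>trajS j) = 0"
      by (subst nn_integral_0_iff_AE) measurable
    then show ?thesis using True unfolding ext by simp
  next
    case False
    then have pos: "0 < ?ip" using ip by simp
    have pm: "(\<lambda>Z. ennreal (pred_density (Suc j) PS pix f Z) * ?H (Z # zs)) \<in> borel_measurable (trajS (Suc j))"
      using measurable_pred_density[OF fd(2)] by measurable
    have pd: "ennreal (pred_num (Suc j) PS pix f Z) = ennreal ?ip * ennreal (pred_density (Suc j) PS pix f Z)" for Z
      using pos pred_density_nonneg[OF fd(1)]
      by (simp flip: ennreal_mult) (simp add: pred_density_def)
    have "?N = ennreal ?ip * (\<integral>\<^sup>+Z. ennreal (pred_density (Suc j) PS pix f Z) * ?H (Z # zs) \<partial>trajS (Suc j))"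
      unfolding pd mult.assoc by (rule nn_integral_cmult[OF pm])
    then show ?thesis using r ip by (simp add: ennreal_mult mult.assoc)
  qed
  have C: "ennreal (1 - r) + ennreal r * ennreal (1 - ?ip) = ennreal (1 - r * ?ip)"
    using r ip by (simp flip: ennreal_mult ennreal_plus) (simp add: algebra_simps)
  have "birthop j r f (\<lambda>xs. foldr F xs G zs) xs
      = ennreal (1 - r) * ?H zs + ennreal r * (ennreal (1 - ?ip) * ?H zs + ?N)"
    unfolding birthop_apply A ..
  also have "\<dots> = (ennreal (1 - r) + ennreal r * ennreal (1 - ?ip)) * ?H zs + ennreal r * ?N"
    by (simp only: distrib_left distrib_right mult.assoc add.assoc)
  also have "\<dots> = birthop (Suc j) (r * ?ip) (pred_density (Suc j) PS pix f) ?H zs"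
    unfolding C B birthop_apply ..
  finally show ?thesis .
qed

text \<open>After one exchange by \<open>birthop_survop\<close> the predicted operator stands
  outside the survival fold. It is then commuted to the inside, so that a survival fold over a
  symmetric function is exposed again for the next prior component. This requires the induction
  hypothesis for all \<open>xs\<close>.\<close>

lemma foldr_birthop_survop:
  assumes f: "\<And>i. i \<in> set ls \<Longrightarrow> traj_density j (f i)" and r: "\<And>i. i \<in> set ls \<Longrightarrow> 0 \<le> r i \<and> r i \<le> 1"
    and G: "list_meas (trajS (Suc j)) G" "perm_inv (traj_space (Suc j)) G"
    and xs: "set xs \<subseteq> traj_space j" and zs: "set zs \<subseteq> traj_space (Suc j)"
  shows "foldr (\<lambda>i. birthop j (r i) (f i)) ls (\<lambda>xs. foldr F xs G zs) xs
    = foldr F xs (foldr (\<lambda>i. birthop (Suc j) (r i * inner_PS (Suc j) PS (f i))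
        (pred_density (Suc j) PS pix (f i))) ls G) zs"
  using f r xs
proof (induction ls arbitrary: xs)
  case (Cons l ls)
  let ?G = "foldr (\<lambda>i. birthop (Suc j) (r i * inner_PS (Suc j) PS (f i)) (pred_density (Suc j) PS pix (f i))) ls G"
  have fm: "f i \<in> borel_measurable (trajS j)" if "i \<in> set (l # ls)" for i
    by (rule traj_densityD(2)[OF Cons.prems(1)[OF that]])
  have lm: "list_meas (trajS (Suc j)) ?G"
    by (intro foldr_birthop_list_meas measurable_pred_density G(1) fm) simp
  have pv: "perm_inv (traj_space (Suc j)) ?G" using G by (intro foldr_birthop_perm_inv)
  have "birthop j (r l) (f l) (foldr (\<lambda>i. birthop j (r i) (f i)) ls (\<lambda>xs. foldr F xs G zs)) xs
      = birthop j (r l) (f l) (\<lambda>xs. foldr F xs ?G zs) xs"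
    by (rule birthop_cong) (use Cons in auto)
  also have "\<dots> = birthop (Suc j) (r l * inner_PS (Suc j) PS (f l)) (pred_density (Suc j) PS pix (f l)) (foldr F xs ?G) zs"
    by (rule birthop_survop) (use Cons.prems lm zs in auto)
  also have "\<dots> = foldr F xs (birthop (Suc j) (r l * inner_PS (Suc j) PS (f l)) (pred_density (Suc j) PS pix (f l)) ?G) zs"
    by (rule foldr_survop_birthop_commute[symmetric])
      (use Cons.prems(3) lm pv zs measurable_pred_density[OF fm[of l]] in auto)
  finally show ?case by simp
qed simp

end

section \<open>Trajectory multi-Bernoulli mixtures\<close>

lemma list_meas_times: "list_meas M F \<Longrightarrow> list_meas M G \<Longrightarrow> list_meas M (\<lambda>xs. F xs * G xs)"
  by (auto simp: list_meas_def intro!: borel_measurable_times_ennreal)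

lemma list_meas_cmult: "list_meas M G \<Longrightarrow> list_meas M (\<lambda>xs. c * G xs)"
  by (auto simp: list_meas_def intro!: borel_measurable_times_ennreal)

lemma list_meas_sum: "(\<And>a. a \<in> A \<Longrightarrow> list_meas M (F a)) \<Longrightarrow> list_meas M (\<lambda>xs. \<Sum>a\<in>A. F a xs)"
  by (auto simp: list_meas_def intro!: borel_measurable_sum)

lemma finite_glob_hyps: "finite (glob_hyps n h hist meas)"
proof -
  have "glob_hyps n h hist meas \<subseteq> PiE {1..n} (\<lambda>i. {1..h i})" by (auto simp: glob_hyps_def)
  then show ?thesis by (rule finite_subset) (auto intro!: finite_PiE)
qed

lemma glob_hypsD:
  assumes "a \<in> glob_hyps n h hist meas"
  shows "a \<in> PiE {1..n} (\<lambda>i. {1..h i})"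
    and "i \<in> {1..n} \<Longrightarrow> hist i (a i) \<subseteq> meas"
    and "i \<in> {1..n} \<Longrightarrow> i' \<in> {1..n} \<Longrightarrow> i \<noteq> i' \<Longrightarrow> hist i (a i) \<inter> hist i' (a i') = {}"
  using assms unfolding glob_hyps_def by blast+

lemma glob_hyps_mem: "a \<in> glob_hyps n h hist meas \<Longrightarrow> i \<in> {1..n} \<Longrightarrow> a i \<in> {1..h i}"
  by (rule PiE_mem[OF glob_hypsD(1)])

text \<open>The mixture is reduced to its global hypotheses. Nonnegativity of weights, probabilities
  and densities lets \<open>ennreal\<close> pass through the sums, and the set density may be
  replaced by \<open>mb_list\<close> because only distinct lists count.\<close>

lemma setintL_mbm:
  fixes f :: "nat \<Rightarrow> nat \<Rightarrow> 'a::euclidean_space traj \<Rightarrow> real"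
  assumes G: "list_meas (trajS k) G"
    and w: "\<And>i a. i \<in> {1..n} \<Longrightarrow> a \<in> {1..h i} \<Longrightarrow> 0 \<le> w i a"
    and r: "\<And>i a. i \<in> {1..n} \<Longrightarrow> a \<in> {1..h i} \<Longrightarrow> 0 \<le> r i a \<and> r i a \<le> 1"
    and f: "\<And>i a X. i \<in> {1..n} \<Longrightarrow> a \<in> {1..h i} \<Longrightarrow> 0 \<le> f i a X"
    and fm: "\<And>i a. i \<in> {1..n} \<Longrightarrow> a \<in> {1..h i} \<Longrightarrow> f i a \<in> borel_measurable (trajS k)"
  shows "setintL k (\<lambda>xs. G xs * ennreal (mbm n h w r f hist meas (set xs)))
    = (\<Sum>a\<in>glob_hyps n h hist meas.
        ennreal ((\<Prod>i\<in>{1..n}. w i (a i)) / (\<Sum>b\<in>glob_hyps n h hist meas. \<Prod>i\<in>{1..n}. w i (b i)))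
        * lsetint (trajS k) (\<lambda>xs. G xs * mb_list n (\<lambda>i. r i (a i)) (\<lambda>i. f i (a i)) xs))"
proof -
  let ?A = "glob_hyps n h hist meas"
  define p where "p a = (\<Prod>i\<in>{1..n}. w i (a i)) / (\<Sum>b\<in>?A. \<Prod>i\<in>{1..n}. w i (b i))" for a
  let ?m = "\<lambda>a. mb_list n (\<lambda>i. r i (a i)) (\<lambda>i. f i (a i))"
  have W: "0 \<le> (\<Prod>i\<in>{1..n}. w i (a i))" if "a \<in> ?A" for a
    by (intro prod_nonneg ballI w glob_hyps_mem[OF that])
  have p: "0 \<le> p a" if "a \<in> ?A" for a
    unfolding p_def by (intro divide_nonneg_nonneg sum_nonneg W that)
  have lm: "list_meas (trajS k) (\<lambda>xs. G xs * ?m a xs)" if "a \<in> ?A" for a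
  proof -
    have "list_meas (trajS k) (?m a)"
      by (intro list_meas_mb_list fm glob_hyps_mem[OF that])
    with G show ?thesis by (rule list_meas_times)
  qed
  have lm': "list_meas (trajS k) (\<lambda>xs. ennreal (p a) * (G xs * ?m a xs))" if "a \<in> ?A" for a
    by (rule list_meas_cmult[OF lm[OF that]])
  have "setintL k (\<lambda>xs. G xs * ennreal (mbm n h w r f hist meas (set xs)))
      = setintL k (\<lambda>xs. \<Sum>a\<in>?A. ennreal (p a) * (G xs * ?m a xs))"
  proof (rule setintL_cong_distinct)
    fix xs :: "'a traj list" assume d: "distinct xs"
    have nn: "0 \<le> mb_set n (\<lambda>i. r i (a i)) (\<lambda>i. f i (a i)) (set xs)" if "a \<in> ?A" for a
      by (intro mb_set_nonneg r f glob_hyps_mem[OF that])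
    have "ennreal (mbm n h w r f hist meas (set xs))
        = ennreal (\<Sum>a\<in>?A. p a * mb_set n (\<lambda>i. r i (a i)) (\<lambda>i. f i (a i)) (set xs))"
      by (simp only: mbm_def Let_def mb_set_def p_def)
    also have "\<dots> = (\<Sum>a\<in>?A. ennreal (p a * mb_set n (\<lambda>i. r i (a i)) (\<lambda>i. f i (a i)) (set xs)))"
      by (intro sum_ennreal[symmetric] mult_nonneg_nonneg p nn)
    also have "\<dots> = (\<Sum>a\<in>?A. ennreal (p a) * ?m a xs)"
    proof (rule sum.cong[OF refl])
      fix a assume a: "a \<in> ?A"
      have "?m a xs = ennreal (mb_set n (\<lambda>i. r i (a i)) (\<lambda>i. f i (a i)) (set xs))"
        by (intro mb_list_eq_mb_set r f glob_hyps_mem[OF a] d)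
      then show "ennreal (p a * mb_set n (\<lambda>i. r i (a i)) (\<lambda>i. f i (a i)) (set xs)) = ennreal (p a) * ?m a xs"
        using p[OF a] nn[OF a] by (simp only: ennreal_mult)
    qed
    finally show "G xs * ennreal (mbm n h w r f hist meas (set xs))
        = (\<Sum>a\<in>?A. ennreal (p a) * (G xs * ?m a xs))"
      by (simp only: sum_distrib_left mult.left_commute)
  qed
  also have "\<dots> = lsetint (trajS k) (\<lambda>xs. \<Sum>a\<in>?A. ennreal (p a) * (G xs * ?m a xs))"
    by (rule setintL_eq_lsetint[OF list_meas_sum[OF lm']])
  also have "\<dots> = (\<Sum>a\<in>?A. lsetint (trajS k) (\<lambda>xs. ennreal (p a) * (G xs * ?m a xs)))"
    by (rule lsetint_sum[OF finite_glob_hyps lm'])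
  also have "\<dots> = (\<Sum>a\<in>?A. ennreal (p a) * lsetint (trajS k) (\<lambda>xs. G xs * ?m a xs))"
    by (intro sum.cong refl lsetint_cmult lm)
  finally show ?thesis unfolding p_def .
qed

lemma list_meas_cong:
  assumes "list_meas M G" "\<And>xs. set xs \<subseteq> space M \<Longrightarrow> G xs = G' xs"
  shows "list_meas M G'"
  unfolding list_meas_def
proof
  fix n
  show "G' \<in> borel_measurable (listM M n)"
    by (rule measurable_cong[THEN iffD1, OF _ list_measD[OF assms(1)]]) (simp add: assms(2) space_listM)
qed

lemma lsetint_mb_list_birthop:
  assumes "\<And>i. i \<in> {1..n} \<Longrightarrow> f i \<in> borel_measurable (trajS k)"
    and "list_meas (trajS k) G" "perm_inv (traj_space k) G"
  shows "lsetint (trajS k) (\<lambda>xs. G xs * mb_list n r f xs) = foldr (\<lambda>i. birthop k (r i) (f i)) [1..<Suc n] G []"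
  unfolding birthop_def by (rule lsetint_mb_list[OF sigma_finite_trajS]) (use assms in \<open>simp_all add: space_trajS\<close>)

section \<open>Prediction for a single global hypothesis\<close>

context surv_model
begin

lemma survE_birthE:
  assumes "\<And>l. l \<in> set ls \<Longrightarrow> g l \<in> borel_measurable (trajS (Suc j))"
    and "list_meas (trajS (Suc j)) (\<lambda>zs. \<phi> (set zs))" "set xs \<subseteq> traj_space j"
  shows "survE (Suc j) PS pix (birthE (Suc j) q g ls) \<phi> xs
    = foldr F xs (foldr (\<lambda>l. birthop (Suc j) (q l) (g l)) ls (\<lambda>zs. \<phi> (set zs))) []"
proof -
  have "survE (Suc j) PS pix (birthE (Suc j) q g ls) \<phi> xs
      = foldr F xs (\<lambda>zs. birthE (Suc j) q g ls (\<lambda>S. \<phi> (set zs \<union> S))) []"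
    using survE_eq_foldr[of "Suc j" PS pix "birthE (Suc j) q g ls" \<phi> "[]" xs] by simp
  also have "\<dots> = foldr F xs (foldr (\<lambda>l. birthop (Suc j) (q l) (g l)) ls (\<lambda>zs. \<phi> (set zs))) []"
    by (rule foldr_survop_cong[OF assms(3)]) (simp_all add: birthE_eq_foldr[OF assms(1,2)])
  finally show ?thesis .
qed

lemma list_meas_survE_birthE:
  assumes "\<And>l. l \<in> set ls \<Longrightarrow> g l \<in> borel_measurable (trajS (Suc j))"
    and "list_meas (trajS (Suc j)) (\<lambda>zs. \<phi> (set zs))"
  shows "list_meas (trajS j) (survE (Suc j) PS pix (birthE (Suc j) q g ls) \<phi>)"
proof (rule list_meas_cong)
  show "list_meas (trajS j) (\<lambda>xs. foldr F xs (foldr (\<lambda>l. birthop (Suc j) (q l) (g l)) ls (\<lambda>zs. \<phi> (set zs))) [])"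
    by (intro foldr_survop_list_meas_list foldr_birthop_list_meas assms) simp_all
qed (simp add: survE_birthE[OF assms] space_trajS)

text \<open>The predicted parameters enter through equations on the old and on the new tracks. The
  case distinctions of the theorem, and the dependence on the hypothesis indices, are thus resolved
  only when the lemma is applied.\<close>

lemma lsetint_transition:
  assumes f: "\<And>i. i \<in> {1..n} \<Longrightarrow> traj_density j (f i)" and r: "\<And>i. i \<in> {1..n} \<Longrightarrow> 0 \<le> r i \<and> r i \<le> 1"
    and g: "\<And>l. l \<in> {1..nb} \<Longrightarrow> g l \<in> borel_measurable (trajS (Suc j))"
    and \<phi>: "list_meas (trajS (Suc j)) (\<lambda>zs. \<phi> (set zs))"
    and r'_old: "\<And>i. i \<in> {1..n} \<Longrightarrow> r' i = r i * inner_PS (Suc j) PS (f i)"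
    and f'_old: "\<And>i. i \<in> {1..n} \<Longrightarrow> f' i = pred_density (Suc j) PS pix (f i)"
    and r'_new: "\<And>l. l \<in> {1..nb} \<Longrightarrow> r' (n + l) = q l"
    and f'_new: "\<And>l. l \<in> {1..nb} \<Longrightarrow> f' (n + l) = g l"
  shows "lsetint (trajS (Suc j)) (\<lambda>zs. \<phi> (set zs) * mb_list (n + nb) r' f' zs)
    = lsetint (trajS j) (\<lambda>xs. survE (Suc j) PS pix (birthE (Suc j) q g [1..<nb + 1]) \<phi> xs * mb_list n r f xs)"
proof -
  let ?G = "foldr (\<lambda>l. birthop (Suc j) (q l) (g l)) [1..<nb + 1] (\<lambda>zs. \<phi> (set zs))"
  have pv: "perm_inv (traj_space (Suc j)) (\<lambda>zs. \<phi> (set zs))"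
    unfolding perm_inv_def by (metis mset_eq_setD)
  have g': "g l \<in> borel_measurable (trajS (Suc j))" if "l \<in> set [1..<nb + 1]" for l
    using g[of l] that by auto
  have G: "list_meas (trajS (Suc j)) ?G" "perm_inv (traj_space (Suc j)) ?G"
    by (rule foldr_birthop_list_meas[OF g' \<phi>]) (assumption, rule foldr_birthop_perm_inv[OF pv])
  have fm: "f i \<in> borel_measurable (trajS j)" if "i \<in> {1..n}" for i
    by (rule traj_densityD(2)[OF f[OF that]])
  have f'm: "f' i \<in> borel_measurable (trajS (Suc j))" if "i \<in> {1..n + nb}" for i
  proof (cases "i \<le> n")
    case True
    then have i: "i \<in> {1..n}" using that by simp
    show ?thesis unfolding f'_old[OF i] by (rule measurable_pred_density[OF fm[OF i]])
  next
    case False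
    then have l: "i - n \<in> {1..nb}" "i = n + (i - n)" using that by auto
    show ?thesis by (subst l(2), subst f'_new[OF l(1)], rule g[OF l(1)])
  qed
  have "lsetint (trajS j) (\<lambda>xs. survE (Suc j) PS pix (birthE (Suc j) q g [1..<nb + 1]) \<phi> xs * mb_list n r f xs)
      = lsetint (trajS j) (\<lambda>xs. foldr F xs ?G [] * mb_list n r f xs)"
    by (rule lsetint_cong) (simp only: survE_birthE[OF g' \<phi>] space_trajS)
  also have "\<dots> = foldr (\<lambda>i. birthop j (r i) (f i)) [1..<Suc n] (\<lambda>xs. foldr F xs ?G []) []"
    by (rule lsetint_mb_list_birthop[OF fm foldr_survop_list_meas_list[OF G(1)] foldr_survop_perm_inv_list[OF G]]) simp_all
  \<comment> \<open>All prior components are exchanged with both lists empty, so the survival fold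
    on the right runs over no trajectories and disappears.\<close>
  also have "\<dots> = foldr F [] (foldr (\<lambda>i. birthop (Suc j) (r i * inner_PS (Suc j) PS (f i))
        (pred_density (Suc j) PS pix (f i))) [1..<Suc n] ?G) []"
    by (rule foldr_birthop_survop[OF _ _ G]) (use f r in auto)
  also have "\<dots> = foldr (\<lambda>i. birthop (Suc j) (r' i) (f' i)) [1..<Suc n] ?G []"
    unfolding foldr.simps id_apply
    by (rule fun_cong[where x = "[]"], rule foldr_cong) (auto simp: r'_old f'_old)
  \<comment> \<open>Birth component \<open>l\<close> becomes track \<open>n + l\<close>. The birth
    operators already stand inside the prior ones, so the two ranges of tracks join into one fold
    without further commutation.\<close>
  also have "?G = foldr (\<lambda>i. birthop (Suc j) (r' i) (f' i)) (map (\<lambda>l. n + l) [1..<nb + 1]) (\<lambda>zs. \<phi> (set zs))"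
    unfolding foldr_map o_def by (rule foldr_cong) (auto simp: r'_new f'_new)
  also have "map (\<lambda>l. n + l) [1..<nb + 1] = [Suc n..<Suc (n + nb)]"
    by (rule nth_equalityI) (simp_all del: upt_Suc)
  also have "foldr (\<lambda>i. birthop (Suc j) (r' i) (f' i)) [1..<Suc n]
        (foldr (\<lambda>i. birthop (Suc j) (r' i) (f' i)) [Suc n..<Suc (n + nb)] (\<lambda>zs. \<phi> (set zs))) []
      = foldr (\<lambda>i. birthop (Suc j) (r' i) (f' i)) [1..<Suc (n + nb)] (\<lambda>zs. \<phi> (set zs)) []"
  proof -
    have "[1..<Suc (n + nb)] = [1..<Suc n] @ [Suc n..<Suc (n + nb)]"
      using upt_add_eq_append[of 1 "Suc n" nb] by simp
    then show ?thesis by simp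
  qed
  also have "\<dots> = lsetint (trajS (Suc j)) (\<lambda>zs. \<phi> (set zs) * mb_list (n + nb) r' f' zs)"
    by (rule lsetint_mb_list_birthop[OF f'm \<phi> pv, symmetric])
  finally show ?thesis by (rule sym)
qed

end

text \<open>A new track has a single hypothesis with empty history: its value in a global hypothesis
  is forced, and it imposes no constraint on the histories of the others.\<close>

lemma glob_hyps_extend:
  fixes n nb :: nat
  defines "E \<equiv> \<lambda>a i. if i \<in> {1..n} then a i else if i \<in> {n + 1..n + nb} then 1 else undefined"
  shows "glob_hyps (n + nb) (\<lambda>i. if i \<le> n then h i else 1) (\<lambda>i a. if i \<le> n then hist i a else {}) meas
      = E ` glob_hyps n h hist meas" (is "?L = _")
    and "inj_on E (glob_hyps n h hist meas)"
proof -
  let ?h = "\<lambda>i. if i \<le> n then h i else 1" and ?hist = "\<lambda>i a. if i \<le> n then hist i a else {}"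
  show "?L = E ` glob_hyps n h hist meas"
  proof (intro equalityI subsetI)
    fix b assume b: "b \<in> ?L"
    note P = glob_hypsD(1)[OF b] and s = glob_hypsD(2)[OF b] and d = glob_hypsD(3)[OF b]
    have "restrict b {1..n} \<in> glob_hyps n h hist meas"
      unfolding glob_hyps_def mem_Collect_eq
    proof (intro conjI ballI impI)
      show "restrict b {1..n} \<in> PiE {1..n} (\<lambda>i. {1..h i})"
        unfolding restrict_PiE_iff
      proof
        fix i assume "i \<in> {1..n}"
        then show "b i \<in> {1..h i}" using PiE_mem[OF P, of i] by auto
      qed
      show "hist i (restrict b {1..n} i) \<subseteq> meas" if "i \<in> {1..n}" for i
        using s[of i] that by auto
      show "hist i (restrict b {1..n} i) \<inter> hist i' (restrict b {1..n} i') = {}"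
        if "i \<in> {1..n}" "i' \<in> {1..n}" "i \<noteq> i'" for i i'
        using d[of i i'] that by simp
    qed
    \<comment> \<open>On new tracks \<open>b\<close> takes values in \<open>{1..1}\<close>, and
      outside all tracks it is \<open>undefined\<close> by extensionality, so \<open>E\<close>
      recovers it.\<close>
    moreover have "E (restrict b {1..n}) = b"
    proof
      fix i
      show "E (restrict b {1..n}) i = b i"
        using PiE_mem[OF P, of i] PiE_arb[OF P, of i] by (auto simp: E_def)
    qed
    ultimately show "b \<in> E ` glob_hyps n h hist meas" by (metis imageI)
  next
    fix b assume "b \<in> E ` glob_hyps n h hist meas"
    then obtain a where b: "b = E a" and a: "a \<in> glob_hyps n h hist meas" by blast
    note P = glob_hypsD(1)[OF a] and s = glob_hypsD(2)[OF a] and d = glob_hypsD(3)[OF a]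
    show "b \<in> ?L"
      unfolding glob_hyps_def mem_Collect_eq b
    proof (intro conjI ballI impI)
      show "E a \<in> PiE {1..n + nb} (\<lambda>i. {1..?h i})"
      proof (rule PiE_I)
        show "E a i \<in> {1..?h i}" if "i \<in> {1..n + nb}" for i
          using PiE_mem[OF P, of i] that by (auto simp: E_def)
      qed (auto simp: E_def)
      show "?hist i (E a i) \<subseteq> meas" if "i \<in> {1..n + nb}" for i
        using s[of i] that by (auto simp: E_def)
      show "?hist i (E a i) \<inter> ?hist i' (E a i') = {}"
        if "i \<in> {1..n + nb}" "i' \<in> {1..n + nb}" "i \<noteq> i'" for i i'
        using d[of i i'] that by (auto simp: E_def)
    qed
  qed
  show "inj_on E (glob_hyps n h hist meas)"
  proof (rule inj_onI)
    fix a b assume ab: "a \<in> glob_hyps n h hist meas" "b \<in> glob_hyps n h hist meas" "E a = E b"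
    show "a = b"
    proof (rule PiE_ext[OF glob_hypsD(1)[OF ab(1)] glob_hypsD(1)[OF ab(2)]])
      fix i assume "i \<in> {1..n}"
      then show "a i = b i" using fun_cong[OF ab(3), of i] by (simp add: E_def)
    qed
  qed
qed

theorem theorem1:
  fixes k n nb :: nat
    and h :: "nat \<Rightarrow> nat"
    and w r :: "nat \<Rightarrow> nat \<Rightarrow> real"
    and f :: "nat \<Rightarrow> nat \<Rightarrow> 'a::euclidean_space traj \<Rightarrow> real"
    and hist :: "nat \<Rightarrow> nat \<Rightarrow> (nat \<times> nat) set"
    and meas :: "(nat \<times> nat) set"
    and PS :: "'a \<Rightarrow> real"
    and pix :: "'a \<Rightarrow> 'a \<Rightarrow> real"
    and rb :: "nat \<Rightarrow> real"
    and fb :: "nat \<Rightarrow> 'a \<Rightarrow> real"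
  assumes k: "1 \<le> k"
    \<comment> \<open>prior trajectory MBM at time k-1\<close>
    and w_nonneg: "\<And>i a. i \<in> {1..n} \<Longrightarrow> a \<in> {1..h i} \<Longrightarrow> 0 \<le> w i a"
    and r_prob: "\<And>i a. i \<in> {1..n} \<Longrightarrow> a \<in> {1..h i} \<Longrightarrow> 0 \<le> r i a \<and> r i a \<le> 1"
    and f_dens: "\<And>i a. i \<in> {1..n} \<Longrightarrow> a \<in> {1..h i} \<Longrightarrow> traj_density (k - 1) (f i a)"
    and meas_times: "\<forall>(\<tau>, j)\<in>meas. \<tau> \<le> k - 1"
    and hist_one: "\<And>i a \<tau> j j'. i \<in> {1..n} \<Longrightarrow> a \<in> {1..h i} \<Longrightarrow>
                     (\<tau>, j) \<in> hist i a \<Longrightarrow> (\<tau>, j') \<in> hist i a \<Longrightarrow> j = j'"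
    and norm_pos: "0 < (\<Sum>a\<in>glob_hyps n h hist meas. \<Prod>i\<in>{1..n}. w i (a i))"
    \<comment> \<open>single-target survival and transition\<close>
    and PS_prob: "\<And>x. 0 \<le> PS x \<and> PS x \<le> 1"
    and PS_meas: "PS \<in> borel_measurable lborel"
    and pix_nonneg: "\<And>x y. 0 \<le> pix x y"
    and pix_meas: "(\<lambda>(x, y). pix x y) \<in> borel_measurable (lborel \<Otimes>\<^sub>M lborel)"
    and pix_dens: "\<And>x. (\<integral>\<^sup>+ y. ennreal (pix x y) \<partial>lborel) = 1"
    \<comment> \<open>trajectory multi-Bernoulli birth\<close>
    and rb_prob: "\<And>l. l \<in> {1..nb} \<Longrightarrow> 0 \<le> rb l \<and> rb l \<le> 1"
    and fb_nonneg: "\<And>l x. l \<in> {1..nb} \<Longrightarrow> 0 \<le> fb l x"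
    and fb_meas: "\<And>l. l \<in> {1..nb} \<Longrightarrow> fb l \<in> borel_measurable lborel"
    and fb_dens: "\<And>l. l \<in> {1..nb} \<Longrightarrow> (\<integral>\<^sup>+ x. ennreal (fb l x) \<partial>lborel) = 1"
  shows
    "(let n' = n + nb;
          h' = (\<lambda>i. if i \<le> n then h i else 1);
          w' = (\<lambda>i a. if i \<le> n then w i a else 1);
          r' = (\<lambda>i a. if i \<le> n then r i a * inner_PS k PS (f i a) else rb (i - n));
          f' = (\<lambda>i a. if i \<le> n then pred_density k PS pix (f i a)
                       else birth_traj_density k (fb (i - n)));
          hist' = (\<lambda>i a. if i \<le> n then hist i a else {})
      in
        (\<forall>\<phi>. set_fun_measurable k \<phi> \<longrightarrow>
           setint k (\<lambda>X. \<phi> X * ennreal (mbm n' h' w' r' f' hist' meas X))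
         = setintL (k - 1) (\<lambda>xs'. ennreal (mbm n h w r f hist meas (set xs')) *
              survE k PS pix (birthE k rb (\<lambda>l. birth_traj_density k (fb l)) [1..<nb + 1]) \<phi> xs'))
      \<and> glob_hyps n' h' hist' meas
          = (\<lambda>a. \<lambda>i. if i \<in> {1..n} then a i else if i \<in> {n + 1..n + nb} then 1 else undefined)
              ` glob_hyps n h hist meas)"
proof -
  obtain j where j: "k = Suc j" using k by (cases k) auto
  interpret surv_model j PS pix
    by unfold_locales (use PS_prob PS_meas pix_nonneg pix_meas in auto)
  let ?A = "glob_hyps n h hist meas"
  define h' where "h' = (\<lambda>i. if i \<le> n then h i else 1)"
  define w' where "w' = (\<lambda>i a. if i \<le> n then w i a else 1)"
  define r' where "r' = (\<lambda>i a. if i \<le> n then r i a * inner_PS k PS (f i a) else rb (i - n))"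
  define f' where "f' = (\<lambda>i a. if i \<le> n then pred_density k PS pix (f i a) else birth_traj_density k (fb (i - n)))"
  define hist' where "hist' = (\<lambda>i a. if i \<le> n then hist i a else {})"
  define E where "E = (\<lambda>a i. if i \<in> {1..n} then a i else if i \<in> {n + 1..n + nb} then 1 else undefined :: nat)"
  let ?A' = "glob_hyps (n + nb) h' hist' meas"
  let ?B = "birthE k rb (\<lambda>l. birth_traj_density k (fb l)) [1..<nb + 1]"
  have A': "?A' = E ` ?A" and E_inj: "inj_on E ?A"
    unfolding h'_def hist'_def E_def by (rule glob_hyps_extend)+
  have fd: "traj_density j (f i a)" if "i \<in> {1..n}" "a \<in> {1..h i}" for i a
    using f_dens[OF that] by (simp add: j)
  have new: "i - n \<in> {1..nb}" if "i \<in> {1..n + nb}" "\<not> i \<le> n" for i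
    using that by auto
  have bm: "birth_traj_density k (fb l) \<in> borel_measurable (trajS k)" if "l \<in> {1..nb}" for l
    by (rule measurable_birth_traj_density[OF fb_meas[OF that]])
  have w'_nonneg: "0 \<le> w' i a" if "i \<in> {1..n + nb}" "a \<in> {1..h' i}" for i a
    using w_nonneg[of i a] that by (auto simp: w'_def h'_def)
  have r'_prob: "0 \<le> r' i a \<and> r' i a \<le> 1" if i: "i \<in> {1..n + nb}" "a \<in> {1..h' i}" for i a
  proof (cases "i \<le> n")
    case True
    then have ia: "i \<in> {1..n}" "a \<in> {1..h i}" using i by (auto simp: h'_def)
    have "inner_PS k PS (f i a) \<le> 1" using survival_mass(3)[OF fd[OF ia]] by (simp add: j)
    with r_prob[OF ia] True show ?thesis
      by (simp add: r'_def inner_PS_nonneg mult_le_one)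
  qed (use rb_prob[OF new[OF i(1)]] in \<open>simp add: r'_def\<close>)
  have f'_nonneg: "0 \<le> f' i a X" if i: "i \<in> {1..n + nb}" "a \<in> {1..h' i}" for i a X
  proof (cases "i \<le> n")
    case True
    then have ia: "i \<in> {1..n}" "a \<in> {1..h i}" using i by (auto simp: h'_def)
    have "0 \<le> pred_density (Suc j) PS pix (f i a) X"
      by (rule pred_density_nonneg) (rule traj_densityD(1)[OF fd[OF ia]])
    with True show ?thesis by (simp add: f'_def j)
  next
    case False
    with fb_nonneg[OF new[OF i(1)]] show ?thesis
      by (simp add: f'_def birth_traj_density_def split: prod.split)
  qed
  have f'_meas: "f' i a \<in> borel_measurable (trajS k)" if i: "i \<in> {1..n + nb}" "a \<in> {1..h' i}" for i a
  proof (cases "i \<le> n")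
    case True
    then have ia: "i \<in> {1..n}" "a \<in> {1..h i}" using i by (auto simp: h'_def)
    with True show ?thesis
      using measurable_pred_density[OF traj_densityD(2)[OF fd[OF ia]]] by (simp add: f'_def j)
  qed (use bm[OF new[OF i(1)]] in \<open>simp add: f'_def\<close>)
  have WE: "(\<Prod>i\<in>{1..n + nb}. w' i (E a i)) = (\<Prod>i\<in>{1..n}. w i (a i))" for a
  proof -
    have "(\<Prod>i\<in>{1..n + nb}. w' i (E a i)) = (\<Prod>i\<in>{1..n}. w' i (E a i))"
      by (rule prod.mono_neutral_right) (auto simp: w'_def)
    also have "\<dots> = (\<Prod>i\<in>{1..n}. w i (a i))"
      by (rule prod.cong) (auto simp: w'_def E_def)
    finally show ?thesis .
  qed
  \<comment> \<open>New tracks contribute the factor 1 and extension is injective, so the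
    normalising constant, and with it every normalised weight, is unchanged.\<close>
  have WA: "(\<Sum>b\<in>?A'. \<Prod>i\<in>{1..n + nb}. w' i (b i)) = (\<Sum>b\<in>?A. \<Prod>i\<in>{1..n}. w i (b i))"
    unfolding A' sum.reindex[OF E_inj] o_def WE ..
  have "setint k (\<lambda>X. \<phi> X * ennreal (mbm (n + nb) h' w' r' f' hist' meas X))
      = setintL (k - 1) (\<lambda>xs'. ennreal (mbm n h w r f hist meas (set xs')) * survE k PS pix ?B \<phi> xs')"
    if \<phi>: "set_fun_measurable k \<phi>" for \<phi>
  proof -
    have \<phi>m: "list_meas (trajS k) (\<lambda>zs. \<phi> (set zs))" by (rule set_fun_measurable_list_meas[OF \<phi>])
    let ?c = "\<lambda>a. ennreal ((\<Prod>i\<in>{1..n}. w i (a i)) / (\<Sum>b\<in>?A. \<Prod>i\<in>{1..n}. w i (b i)))"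
    \<comment> \<open>On old tracks \<open>E a\<close> agrees with \<open>a\<close>; on new tracks
      the predicted parameters do not depend on the hypothesis index. This supplies the four
      equations of \<open>lsetint_transition\<close>.\<close>
    have step: "lsetint (trajS k) (\<lambda>zs. \<phi> (set zs) * mb_list (n + nb) (\<lambda>i. r' i (E a i)) (\<lambda>i. f' i (E a i)) zs)
        = lsetint (trajS j) (\<lambda>xs. survE k PS pix ?B \<phi> xs * mb_list n (\<lambda>i. r i (a i)) (\<lambda>i. f i (a i)) xs)"
      if a: "a \<in> ?A" for a
      unfolding j
      by (rule lsetint_transition)
        (use fd r_prob bm \<phi>m glob_hyps_mem[OF a] in \<open>auto simp: j r'_def f'_def E_def\<close>)
    have sm: "list_meas (trajS j) (survE k PS pix ?B \<phi>)"
      unfolding j by (rule list_meas_survE_birthE) (use bm \<phi>m in \<open>auto simp: j\<close>)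
    have "setint k (\<lambda>X. \<phi> X * ennreal (mbm (n + nb) h' w' r' f' hist' meas X))
        = setintL k (\<lambda>zs. \<phi> (set zs) * ennreal (mbm (n + nb) h' w' r' f' hist' meas (set zs)))"
      by (simp only: setint_def)
    also have "\<dots> = (\<Sum>b\<in>?A'. ennreal ((\<Prod>i\<in>{1..n + nb}. w' i (b i)) / (\<Sum>b\<in>?A'. \<Prod>i\<in>{1..n + nb}. w' i (b i)))
        * lsetint (trajS k) (\<lambda>zs. \<phi> (set zs) * mb_list (n + nb) (\<lambda>i. r' i (b i)) (\<lambda>i. f' i (b i)) zs))"
      by (rule setintL_mbm[OF \<phi>m w'_nonneg r'_prob f'_nonneg f'_meas])
    also have "\<dots> = (\<Sum>a\<in>?A. ?c a * lsetint (trajS k)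
          (\<lambda>zs. \<phi> (set zs) * mb_list (n + nb) (\<lambda>i. r' i (E a i)) (\<lambda>i. f' i (E a i)) zs))"
      unfolding WA unfolding A' sum.reindex[OF E_inj] o_def WE ..
    also have "\<dots> = (\<Sum>a\<in>?A. ?c a * lsetint (trajS j)
          (\<lambda>xs. survE k PS pix ?B \<phi> xs * mb_list n (\<lambda>i. r i (a i)) (\<lambda>i. f i (a i)) xs))"
      by (intro sum.cong refl arg_cong2[where f = times] step)
    also have "\<dots> = setintL j (\<lambda>xs. survE k PS pix ?B \<phi> xs * ennreal (mbm n h w r f hist meas (set xs)))"
      by (rule setintL_mbm[symmetric, OF sm w_nonneg r_prob traj_densityD(1)[OF fd] traj_densityD(2)[OF fd]])
    finally show ?thesis by (simp only: j diff_Suc_1 mult.commute)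
  qed
  with A' show ?thesis
    unfolding Let_def h'_def w'_def r'_def f'_def hist'_def E_def by blast
qed

end
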